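(* Let $E\in\mathbb{R}$ be fixed, let $A(E):=\{\omega\in\Omega: E\in\sigma_p(H_\omega)\}$, and let $B$ be any measurable subset of $A(E)$. Then one of the following holds: (i) $\mathbb{P}(B)=0$; (ii) $A(E)=\Omega$.
   Context: Probability space: let $I\subseteq\mathbb{Z}$ and let $\{p_n\}_{n\in I}$ be probability measures on $\mathbb{R}$ that are continuous, i.e. $p_n(\{r\})=0$ for all $r\in\mathbb{R}$. $\Omega$ denotes the completion of the product probability space $(\mathbb{R}^I,\mathcal{F},\mathbb{P})$, where $\mathbb{P}=\times_{n\in I}p_n$ and $\mathcal{F}$ is the product $\sigma$-algebra generated by cylinder sets; elements are sequences $\omega=\{\omega(n)\}_{n\in I}$, and "measurable" refers to the completed $\sigma$-algebra. Operators ($\delta$-interactions): let $-\infty\le a<b\le\infty$, let $V\in L^1_{loc}(a,b)$ be real valued, and let $M=\{x_n\}_{n\in I}\subset(a,b)$ be a discrete set of distinct points which accumulate at most at $a$ or $b$. Let $\tau f=-f''+Vf$. For $\omega\in\Omega$, the formal expression $\tau_\omega=-\frac{d^2}{dx^2}+V(x)+\sum_{n\in I}\omega(n)\delta(x-x_n)$ has maximal operator $T_\omega f=\tau f$ with domain $D(T_\omega)$ consisting of all $f\in L^2(a,b)$ such that $f,f'$ are (locally) absolutely continuous in $(a,b)\setminus M$, $-f''+Vf\in L^2(a,b)$, and $f(x_n+)=f(x_n-)$, $f'(x_n+)-f'(x_n-)=\omega(n)f(x_n)$ for all $n\in I$. A solution of $(\tau_\omega-z)f=0$ ($z\in\mathbb{C}$)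 is a function $f$ with $f,f'$ (locally) absolutely continuous in $(a,b)\setminus M$, $-f''+Vf-zf=0$, satisfying the same conditions at all $x_n$. $\tau_\omega$ is regular at $a$ if $a$ is finite, $V\in L^1_{loc}[a,b)$ and $a$ is not an accumulation point of $M$; it is in the limit point case (lpc) at $a$ if for every $z\in\mathbb{C}$ there is at least one solution of $(\tau_\omega-z)f=0$ which is not square integrable near $a$; similarly at $b$. Standing assumption: at each of the endpoints $a$, $b$, $\tau_\omega$ is either regular or in the limit point case (for the operators $H_\omega$, $\omega\in\Omega$). For fixed $\theta,\gamma\in[0,\pi)$, $H_\omega$ is the selfadjoint restriction of $T_\omega$ to those $f\in D(T_\omega)$ satisfying $f(a)\cos\theta+f'(a)\sin\theta=0$ if $\tau_\omega$ is regular at $a$, and $f(b)\cos\gamma+f'(b)\sin\gamma=0$ if $\tau_\omega$ is regular at $b$ (no condition at an lpc endpoint). $\sigma_p(L)$ denotes the set of eigenvalues of $L$. *)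

theory Defs
  imports "HOL-Probability.Probability"
begin

section \<open>Function spaces\<close>

text \<open>The usual epsilon-delta notion on a compact interval. A finite family of non-overlapping
  compact intervals is expressed as a division of its own union.\<close>

definition abs_continuous_on :: "real set \<Rightarrow> (real \<Rightarrow> complex) \<Rightarrow> bool" where
  "abs_continuous_on S f \<longleftrightarrow>
     (\<forall>\<epsilon>>0. \<exists>\<delta>>0. \<forall>D. D division_of \<Union>D \<and> \<Union>D \<subseteq> S \<and> (\<Sum>k\<in>D. Sup k - Inf k) < \<delta> \<longrightarrow>
        (\<Sum>k\<in>D. cmod (f (Sup k) - f (Inf k))) < \<epsilon>)"

definition loc_abs_continuous_on :: "real set \<Rightarrow> (real \<Rightarrow> complex) \<Rightarrow> bool" where
  "loc_abs_continuous_on S f \<longleftrightarrow> (\<forall>c d. c \<le> d \<and> {c..d} \<subseteq> S \<longrightarrow> abs_continuous_on {c..d} f)"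

definition L1_loc :: "real set \<Rightarrow> (real \<Rightarrow> real) \<Rightarrow> bool" where
  "L1_loc S V \<longleftrightarrow> (\<forall>c d. c \<le> d \<and> {c..d} \<subseteq> S \<longrightarrow> set_integrable lebesgue {c..d} V)"

text \<open>Representatives of the elements of the Hilbert space; equality in that space is equality
  almost everywhere.\<close>

definition L2 :: "real set \<Rightarrow> (real \<Rightarrow> complex) set" where
  "L2 S = {f. f \<in> borel_measurable (lebesgue_on S) \<and>
              integrable (lebesgue_on S) (\<lambda>y. (cmod (f y))\<^sup>2)}"

abbreviation vderiv :: "(real \<Rightarrow> complex) \<Rightarrow> real \<Rightarrow> complex" where
  "vderiv f \<equiv> (\<lambda>y. vector_derivative f (at y))"


section \<open>Sturm-Liouville expressions with delta-interactions\<close>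

text \<open>The one-sided limits are required to exist; l is the value of f at the interaction
  point. The number assigned by f itself to that point plays no role.\<close>

definition delta_conditions ::
  "int set \<Rightarrow> (int \<Rightarrow> real) \<Rightarrow> (int \<Rightarrow> real) \<Rightarrow> (real \<Rightarrow> complex) \<Rightarrow> bool" where
  "delta_conditions I x \<omega> f \<longleftrightarrow>
     (\<forall>n\<in>I. \<exists>l dl dr.
        (f \<longlongrightarrow> l) (at_left (x n)) \<and> (f \<longlongrightarrow> l) (at_right (x n)) \<and>
        (vderiv f \<longlongrightarrow> dl) (at_left (x n)) \<and> (vderiv f \<longlongrightarrow> dr) (at_right (x n)) \<and>
        dr - dl = complex_of_real (\<omega> n) * l)"

text \<open>The relation: f has the required regularity, satisfies all interface conditions and
  -f'' + V f = g. As f' is locally absolutely continuous, f'' is defined almost everywhere only,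
  so the equation reads: f' has derivative V f - g almost everywhere.\<close>

definition delta_expr ::
  "ereal \<Rightarrow> ereal \<Rightarrow> (real \<Rightarrow> real) \<Rightarrow> int set \<Rightarrow> (int \<Rightarrow> real) \<Rightarrow> (int \<Rightarrow> real) \<Rightarrow>
   (real \<Rightarrow> complex) \<Rightarrow> (real \<Rightarrow> complex) \<Rightarrow> bool" where
  "delta_expr a b V I x \<omega> f g \<longleftrightarrow>
     loc_abs_continuous_on (einterval a b - x ` I) f \<and>
     (\<forall>y \<in> einterval a b - x ` I. f differentiable (at y)) \<and>
     loc_abs_continuous_on (einterval a b - x ` I) (vderiv f) \<and>
     (AE y in lebesgue_on (einterval a b).
        (vderiv f has_vector_derivative (complex_of_real (V y) * f y - g y)) (at y)) \<and>
     delta_conditions I x \<omega> f"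

definition is_solution ::
  "ereal \<Rightarrow> ereal \<Rightarrow> (real \<Rightarrow> real) \<Rightarrow> int set \<Rightarrow> (int \<Rightarrow> real) \<Rightarrow> (int \<Rightarrow> real) \<Rightarrow>
   complex \<Rightarrow> (real \<Rightarrow> complex) \<Rightarrow> bool" where
  "is_solution a b V I x \<omega> z f \<longleftrightarrow> delta_expr a b V I x \<omega> f (\<lambda>y. z * f y)"

definition regular_left ::
  "ereal \<Rightarrow> ereal \<Rightarrow> (real \<Rightarrow> real) \<Rightarrow> int set \<Rightarrow> (int \<Rightarrow> real) \<Rightarrow> bool" where
  "regular_left a b V I x \<longleftrightarrow>
     \<bar>a\<bar> \<noteq> \<infinity> \<and> L1_loc {y. a \<le> ereal y \<and> ereal y < b} V \<and> \<not> real_of_ereal a islimpt x ` I"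

definition regular_right ::
  "ereal \<Rightarrow> ereal \<Rightarrow> (real \<Rightarrow> real) \<Rightarrow> int set \<Rightarrow> (int \<Rightarrow> real) \<Rightarrow> bool" where
  "regular_right a b V I x \<longleftrightarrow>
     \<bar>b\<bar> \<noteq> \<infinity> \<and> L1_loc {y. a < ereal y \<and> ereal y \<le> b} V \<and> \<not> real_of_ereal b islimpt x ` I"

definition lpc_left ::
  "ereal \<Rightarrow> ereal \<Rightarrow> (real \<Rightarrow> real) \<Rightarrow> int set \<Rightarrow> (int \<Rightarrow> real) \<Rightarrow> (int \<Rightarrow> real) \<Rightarrow> bool" where
  "lpc_left a b V I x \<omega> \<longleftrightarrow>
     (\<forall>z. \<exists>f. is_solution a b V I x \<omega> z f \<and>
        (\<forall>c. a < ereal c \<and> ereal c < b \<longrightarrow> f \<notin> L2 (einterval a (ereal c))))"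

definition lpc_right ::
  "ereal \<Rightarrow> ereal \<Rightarrow> (real \<Rightarrow> real) \<Rightarrow> int set \<Rightarrow> (int \<Rightarrow> real) \<Rightarrow> (int \<Rightarrow> real) \<Rightarrow> bool" where
  "lpc_right a b V I x \<omega> \<longleftrightarrow>
     (\<forall>z. \<exists>f. is_solution a b V I x \<omega> z f \<and>
        (\<forall>c. a < ereal c \<and> ereal c < b \<longrightarrow> f \<notin> L2 (einterval (ereal c) b)))"


section \<open>The operators and their point spectrum\<close>

text \<open>Operators are given by their graphs, as sets of pairs of representatives.\<close>

type_synonym op_graph = "((real \<Rightarrow> complex) \<times> (real \<Rightarrow> complex)) set"

definition T_op ::
  "ereal \<Rightarrow> ereal \<Rightarrow> (real \<Rightarrow> real) \<Rightarrow> int set \<Rightarrow> (int \<Rightarrow> real) \<Rightarrow> (int \<Rightarrow> real) \<Rightarrow> op_graph" where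
  "T_op a b V I x \<omega> =
     {(f, g). f \<in> L2 (einterval a b) \<and> g \<in> L2 (einterval a b) \<and> delta_expr a b V I x \<omega> f g}"

text \<open>A boundary condition with angle \<phi>, the boundary values being one-sided limits along the
  filter F.\<close>

definition boundary_condition :: "real filter \<Rightarrow> real \<Rightarrow> (real \<Rightarrow> complex) \<Rightarrow> bool" where
  "boundary_condition F \<phi> f \<longleftrightarrow>
     (\<exists>l d. (f \<longlongrightarrow> l) F \<and> (vderiv f \<longlongrightarrow> d) F \<and>
        l * complex_of_real (cos \<phi>) + d * complex_of_real (sin \<phi>) = 0)"

definition H_op ::
  "ereal \<Rightarrow> ereal \<Rightarrow> (real \<Rightarrow> real) \<Rightarrow> int set \<Rightarrow> (int \<Rightarrow> real) \<Rightarrow> real \<Rightarrow> real \<Rightarrow> (int \<Rightarrow> real) \<Rightarrow>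
   op_graph" where
  "H_op a b V I x \<theta> \<gamma> \<omega> =
     {(f, g) \<in> T_op a b V I x \<omega>.
        (regular_left a b V I x \<longrightarrow> boundary_condition (at_right (real_of_ereal a)) \<theta> f) \<and>
        (regular_right a b V I x \<longrightarrow> boundary_condition (at_left (real_of_ereal b)) \<gamma> f)}"

definition point_spectrum :: "real set \<Rightarrow> op_graph \<Rightarrow> complex set" where
  "point_spectrum S G =
     {z. \<exists>(f, g) \<in> G. (AE y in lebesgue_on S. g y = z * f y) \<and> \<not> (AE y in lebesgue_on S. f y = 0)}"


section \<open>The probability space\<close>

abbreviation Omega :: "int set \<Rightarrow> (int \<Rightarrow> real measure) \<Rightarrow> (int \<Rightarrow> real) measure" where
  "Omega I p \<equiv> completion (PiM I p)"

definition A_set ::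
  "ereal \<Rightarrow> ereal \<Rightarrow> (real \<Rightarrow> real) \<Rightarrow> int set \<Rightarrow> (int \<Rightarrow> real) \<Rightarrow> real \<Rightarrow> real \<Rightarrow>
   (int \<Rightarrow> real measure) \<Rightarrow> real \<Rightarrow> (int \<Rightarrow> real) set" where
  "A_set a b V I x \<theta> \<gamma> p E =
     {\<omega> \<in> space (Omega I p).
        complex_of_real E \<in> point_spectrum (einterval a b) (H_op a b V I x \<theta> \<gamma> \<omega>)}"

end

theory Submission
  imports Defs
begin

text \<open>
The coupling constant at \<open>x n\<close> acts like a rank-one perturbation that sees an eigenfunction only through its
value at \<open>x n\<close>. If an eigenfunction \<open>f\<close> for \<open>E\<close> vanishes at all interaction points, no coupling constant
matters and \<open>f\<close> is an eigenfunction for every sequence of coupling constants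
(\<open>eigenfunction_change_couplings\<close>), so \<open>A(E)\<close> is the whole space. It remains to find such an \<open>f\<close> when \<open>B\<close>
has positive measure.

The measure-theoretic half is Fubini. Since the \<open>p n\<close> are continuous, a set \<open>B\<close> of positive measure contains
a point \<open>w\<close> such that for each \<open>n\<close> another point of \<open>B\<close> differs from \<open>w\<close> in the coordinate \<open>n\<close> only
(\<open>ex_point_with_other_points_on_all_lines\<close>).

The analytic half is that \<open>E\<close> can be an eigenvalue for two sequences that differ exactly at \<open>n\<close> only if
the eigenfunctions of the first vanish at \<open>x n\<close> (\<open>eigenfunction_vanishes\<close>). The Wronskian of the two
eigenfunctions is constant on each side of \<open>x n\<close> (\<open>wronskian_const\<close>). It is zero near a regular end
because of the common boundary condition, and near a limit point end because two linearly independent square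
integrable solutions would make all solutions square integrable (\<open>wronskian_zero\<close>). Comparison of the two
sides at \<open>x n\<close> and uniqueness for the Cauchy problem (\<open>zero_data_imp_zero\<close>) finish the argument.

Solutions are locally absolutely continuous and satisfy the equation almost everywhere; all uses of the
equation go through the fundamental theorem of calculus \<open>abs_continuous_on_has_integral\<close>.
\<close>

section \<open>Absolutely continuous functions\<close>

lemma abs_continuous_onD:
  assumes "abs_continuous_on S f" "\<epsilon> > 0"
  obtains \<delta> where "\<delta> > 0"
    "\<forall>D. D division_of \<Union>D \<and> \<Union>D \<subseteq> S \<and> (\<Sum>k\<in>D. Sup k - Inf k) < \<delta>
      \<longrightarrow> (\<Sum>k\<in>D. cmod (f (Sup k) - f (Inf k))) < \<epsilon>"
proof -
  from assms(1)[unfolded abs_continuous_on_def, THEN spec, THEN mp, OF assms(2)]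
  obtain \<delta> where *: "\<delta> > 0 \<and> (\<forall>D. D division_of \<Union>D \<and> \<Union>D \<subseteq> S \<and> (\<Sum>k\<in>D. Sup k - Inf k) < \<delta>
      \<longrightarrow> (\<Sum>k\<in>D. cmod (f (Sup k) - f (Inf k))) < \<epsilon>)" ..
  show thesis
    by (rule that[of \<delta>, OF conjunct1[OF *]]) (rule conjunct2[OF *])
qed

lemma abs_continuous_on_imp_continuous_on:
  assumes "abs_continuous_on {c..d} f"
  shows "continuous_on {c..d} f"
  unfolding continuous_on_iff
proof (intro ballI allI impI)
  fix t e :: real assume t: "t \<in> {c..d}" and e: "0 < e"
  obtain \<delta> where \<delta>: "\<delta> > 0" and AC:
    "\<forall>D. D division_of \<Union>D \<and> \<Union>D \<subseteq> {c..d} \<and> (\<Sum>k\<in>D. Sup k - Inf k) < \<delta> \<longrightarrow>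
        (\<Sum>k\<in>D. cmod (f (Sup k) - f (Inf k))) < e"
    by (rule abs_continuous_onD[OF assms e])
  have *: "cmod (f v - f u) < e" if "u \<le> v" "c \<le> u" "v \<le> d" "v - u < \<delta>" for u v
    using AC[THEN spec, of "{{u..v}}"] that division_of_self[of u v] by auto
  have "dist (f y) (f t) < e" if "y \<in> {c..d}" "dist y t < \<delta>" for y
    using *[of y t] *[of t y] t that
    by (cases "y \<le> t") (auto simp: dist_norm norm_minus_commute abs_if split: if_splits)
  then show "\<exists>\<delta>>0. \<forall>y\<in>{c..d}. dist y t < \<delta> \<longrightarrow> dist (f y) (f t) < e"
    using \<delta> by blast
qed

lemma abs_continuous_on_diff:
  assumes "abs_continuous_on S f" "abs_continuous_on S g"
  shows "abs_continuous_on S (\<lambda>y. f y - g y)"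
  unfolding abs_continuous_on_def
proof (intro allI impI)
  fix e :: real assume "e > 0"
  then have e2: "e / 2 > 0" by simp
  obtain d1 where d1: "d1 > 0"
    "\<forall>D. D division_of \<Union>D \<and> \<Union>D \<subseteq> S \<and> (\<Sum>k\<in>D. Sup k - Inf k) < d1 \<longrightarrow>
      (\<Sum>k\<in>D. cmod (f (Sup k) - f (Inf k))) < e / 2"
    by (rule abs_continuous_onD[OF assms(1) e2])
  obtain d2 where d2: "d2 > 0"
    "\<forall>D. D division_of \<Union>D \<and> \<Union>D \<subseteq> S \<and> (\<Sum>k\<in>D. Sup k - Inf k) < d2 \<longrightarrow>
      (\<Sum>k\<in>D. cmod (g (Sup k) - g (Inf k))) < e / 2"
    by (rule abs_continuous_onD[OF assms(2) e2])
  show "\<exists>d>0. \<forall>D. D division_of \<Union>D \<and> \<Union>D \<subseteq> S \<and> (\<Sum>k\<in>D. Sup k - Inf k) < d \<longrightarrow>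
     (\<Sum>k\<in>D. cmod ((f (Sup k) - g (Sup k)) - (f (Inf k) - g (Inf k)))) < e"
  proof (intro exI[of _ "min d1 d2"] conjI allI impI)
    fix D assume D: "D division_of \<Union>D \<and> \<Union>D \<subseteq> S \<and> (\<Sum>k\<in>D. Sup k - Inf k) < min d1 d2"
    have "(\<Sum>k\<in>D. cmod ((f (Sup k) - g (Sup k)) - (f (Inf k) - g (Inf k))))
       \<le> (\<Sum>k\<in>D. cmod (f (Sup k) - f (Inf k)) + cmod (g (Sup k) - g (Inf k)))"
      by (intro sum_mono) norm
    also have "\<dots> < e" using d1(2)[THEN spec, of D] d2(2)[THEN spec, of D] D by (simp add: sum.distrib)
    finally show "(\<Sum>k\<in>D. cmod ((f (Sup k) - g (Sup k)) - (f (Inf k) - g (Inf k)))) < e" .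
  qed (use d1 d2 in auto)
qed

lemma abs_continuous_on_mult:
  assumes f: "abs_continuous_on {c..d} f" and g: "abs_continuous_on {c..d} g"
  shows "abs_continuous_on {c..d} (\<lambda>y. f y * g y)"
proof -
  obtain A where A: "A > 0" "\<And>y. y \<in> {c..d} \<Longrightarrow> cmod (f y) \<le> A"
    using compact_imp_bounded[OF compact_continuous_image[OF abs_continuous_on_imp_continuous_on[OF f] compact_Icc]]
    unfolding bounded_pos by auto
  obtain B where B: "B > 0" "\<And>y. y \<in> {c..d} \<Longrightarrow> cmod (g y) \<le> B"
    using compact_imp_bounded[OF compact_continuous_image[OF abs_continuous_on_imp_continuous_on[OF g] compact_Icc]]
    unfolding bounded_pos by auto
  show ?thesis
    unfolding abs_continuous_on_def
  proof (intro allI impI)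
    fix e :: real assume "e > 0"
    then have eB: "e / (2 * B) > 0" and eA: "e / (2 * A) > 0" using A(1) B(1) by simp_all
    obtain d1 where d1: "d1 > 0"
      "\<forall>D. D division_of \<Union>D \<and> \<Union>D \<subseteq> {c..d} \<and> (\<Sum>k\<in>D. Sup k - Inf k) < d1 \<longrightarrow>
        (\<Sum>k\<in>D. cmod (f (Sup k) - f (Inf k))) < e / (2 * B)"
      by (rule abs_continuous_onD[OF f eB])
    obtain d2 where d2: "d2 > 0"
      "\<forall>D. D division_of \<Union>D \<and> \<Union>D \<subseteq> {c..d} \<and> (\<Sum>k\<in>D. Sup k - Inf k) < d2 \<longrightarrow>
        (\<Sum>k\<in>D. cmod (g (Sup k) - g (Inf k))) < e / (2 * A)"
      by (rule abs_continuous_onD[OF g eA])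
    show "\<exists>\<delta>>0. \<forall>D. D division_of \<Union>D \<and> \<Union>D \<subseteq> {c..d} \<and> (\<Sum>k\<in>D. Sup k - Inf k) < \<delta> \<longrightarrow>
       (\<Sum>k\<in>D. cmod (f (Sup k) * g (Sup k) - f (Inf k) * g (Inf k))) < e"
    proof (intro exI[of _ "min d1 d2"] conjI allI impI)
      fix D assume D: "D division_of \<Union>D \<and> \<Union>D \<subseteq> {c..d} \<and> (\<Sum>k\<in>D. Sup k - Inf k) < min d1 d2"
      have "(\<Sum>k\<in>D. cmod (f (Sup k) * g (Sup k) - f (Inf k) * g (Inf k)))
         \<le> (\<Sum>k\<in>D. B * cmod (f (Sup k) - f (Inf k)) + A * cmod (g (Sup k) - g (Inf k)))"
      proof (rule sum_mono)
        fix k assume k: "k \<in> D"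
        then obtain u v where uv: "k = cbox u v" "k \<noteq> {}" "k \<subseteq> {c..d}"
          using D by (metis Sup_le_iff division_ofD(3) division_ofD(4))
        then have b: "cmod (f (Inf k)) \<le> A" "cmod (g (Sup k)) \<le> B"
          using A B by (auto intro!: A B)
        have "f (Sup k) * g (Sup k) - f (Inf k) * g (Inf k)
          = g (Sup k) * (f (Sup k) - f (Inf k)) + f (Inf k) * (g (Sup k) - g (Inf k))"
          by (simp add: algebra_simps)
        also have "cmod \<dots> \<le> cmod (g (Sup k)) * cmod (f (Sup k) - f (Inf k)) + cmod (f (Inf k)) * cmod (g (Sup k) - g (Inf k))"
          by (metis norm_mult norm_triangle_ineq)
        also have "\<dots> \<le> B * cmod (f (Sup k) - f (Inf k)) + A * cmod (g (Sup k) - g (Inf k))"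
          using b by (intro add_mono mult_right_mono) auto
        finally show "cmod (f (Sup k) * g (Sup k) - f (Inf k) * g (Inf k))
           \<le> B * cmod (f (Sup k) - f (Inf k)) + A * cmod (g (Sup k) - g (Inf k))" .
      qed
      also have "\<dots> = B * (\<Sum>k\<in>D. cmod (f (Sup k) - f (Inf k))) + A * (\<Sum>k\<in>D. cmod (g (Sup k) - g (Inf k)))"
        by (simp add: sum.distrib sum_distrib_left)
      also have "\<dots> < B * (e / (2*B)) + A * (e / (2*A))"
        using d1(2)[THEN spec, of D] d2(2)[THEN spec, of D] D A(1) B(1) by (intro add_strict_mono mult_strict_left_mono) auto
      also have "\<dots> = e" using A(1) B(1) by simp
      finally show "(\<Sum>k\<in>D. cmod (f (Sup k) * g (Sup k) - f (Inf k) * g (Inf k))) < e" .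
    qed (use d1 d2 in auto)
  qed
qed

text \<open>The gauge integral gives this half of the fundamental theorem directly. At a
tag where \<open>F\<close> is differentiable, a small ball makes the increment of \<open>F\<close> almost linear. Tags in the
null set \<open>N\<close> get as gauge one open set \<open>U\<close> that contains \<open>N\<close> and has small measure; the intervals
there have small total length, so by absolute continuity \<open>F\<close> changes little on all of them together.
This turns a differential equation that holds almost everywhere into an identity at all points.\<close>

lemma abs_continuous_on_has_integral:
  assumes cd: "c \<le> d" and AC: "abs_continuous_on {c..d} F" and N: "negligible N"
    and deriv: "\<And>y. y \<in> {c..d} - N \<Longrightarrow> (F has_vector_derivative g y) (at y within {c..d})"
  shows "(g has_integral (F d - F c)) {c..d}"
proof -
  \<comment> \<open>The integrand is set to zero on \<open>N\<close>, so that tags there contribute no Riemann sum term.\<close>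
  define g0 where "g0 y = (if y \<in> N then 0 else g y)" for y
  have "(g0 has_integral (F d - F c)) (cbox c d)"
    unfolding has_integral
  proof (intro allI impI)
    fix e :: real assume e: "e > 0"
    obtain \<delta> where \<delta>: "\<delta> > 0" and AC\<delta>:
      "\<forall>D. D division_of \<Union>D \<and> \<Union>D \<subseteq> {c..d} \<and> (\<Sum>k\<in>D. Sup k - Inf k) < \<delta> \<longrightarrow>
        (\<Sum>k\<in>D. cmod (F (Sup k) - F (Inf k))) < e / 2"
      by (rule abs_continuous_onD[OF AC half_gt_zero[OF e]])
    obtain U where U: "open U" "N \<subseteq> U" "U \<in> lmeasurable" "measure lebesgue U < \<delta>"
    proof -
      have NL: "N \<in> sets lebesgue" "N \<in> null_sets lebesgue"
        using N by (auto simp: negligible_iff_null_sets)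
      obtain T where T: "open T" "N \<subseteq> T" "(T - N) \<in> lmeasurable" "emeasure lebesgue (T - N) < ennreal \<delta>"
        using sets_lebesgue_outer_open[OF NL(1) \<delta>] by auto
      have eq: "emeasure lebesgue T = emeasure lebesgue (T - N)"
        using emeasure_Diff_null_set[OF NL(2)] T(1) by simp
      have "T \<in> lmeasurable"
        using T eq by (intro fmeasurableI) (auto simp: order_less_trans ennreal_less_top intro: le_less_trans less_top[THEN iffD1])
      moreover have "measure lebesgue T < \<delta>"
        using T(4) \<delta> eq by (metis calculation emeasure_eq_measure2 ennreal_less_iff measure_nonneg)
      ultimately show thesis using that T by blast
    qed
    \<comment> \<open>The summand 1 keeps the denominator positive when \<open>c = d\<close>.\<close>
    define e' where "e' = e / (2 * (d - c) + 1)"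
    have e': "e' > 0" "e' * (d - c) < e / 2"
      using e cd by (auto simp: e'_def field_simps)
    have "\<exists>r>0. \<forall>y\<in>{c..d}. \<bar>y - t\<bar> < r \<longrightarrow> cmod (F y - F t - (y - t) *\<^sub>R g t) \<le> e' * \<bar>y - t\<bar>"
      if "t \<in> {c..d} - N" for t
      using deriv[OF that] e'(1)
      unfolding has_vector_derivative_def has_derivative_within_alt by auto
    then obtain r where r: "\<And>t. t \<in> {c..d} - N \<Longrightarrow> r t > 0"
      "\<And>t y. \<lbrakk>t \<in> {c..d} - N; y \<in> {c..d}; \<bar>y - t\<bar> < r t\<rbrakk>
          \<Longrightarrow> cmod (F y - F t - (y - t) *\<^sub>R g t) \<le> e' * \<bar>y - t\<bar>"
      by metis
    define \<gamma> where "\<gamma> t = (if t \<in> N then U else if t \<in> {c..d} then ball t (r t) else ball t 1)" for t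
    have gauge: "gauge \<gamma>"
      using U r by (auto simp: gauge_def \<gamma>_def)
    have est: "cmod ((\<Sum>(t, K)\<in>p. measure lborel K *\<^sub>R g0 t) - (F d - F c)) < e"
      if ptag: "p tagged_division_of cbox c d" and fine: "\<gamma> fine p" for p
    proof -
      have fin: "finite p" using ptag by blast
      have box: "\<exists>u v. K = {u..v} \<and> u \<le> v \<and> t \<in> K \<and> c \<le> u \<and> v \<le> d" if tK: "(t, K) \<in> p" for t K
      proof -
        obtain u v where "K = cbox u v" "t \<in> K" "K \<subseteq> cbox c d"
          using tagged_division_ofD(2,3,4)[OF ptag tK] by metis
        then show ?thesis by (intro exI[of _ u] exI[of _ v]) auto
      qed
      define q where "q = {(t, K). (t, K) \<in> p \<and> t \<in> N}"
      have q: "q \<subseteq> p" by (auto simp: q_def)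
      have sumF: "F d - F c = (\<Sum>(t, K)\<in>p. F (Sup K) - F (Inf K))"
        using additive_tagged_division_1[of c d p F] cd ptag by simp
      have sumI: "d - c = (\<Sum>(t, K)\<in>p. Sup K - Inf K)"
        using additive_tagged_division_1[of c d p "\<lambda>y. y"] cd ptag by simp
      \<comment> \<open>Straddle lemma on each interval whose tag lies outside \<open>N\<close>.\<close>
      have "cmod (\<Sum>z\<in>p - q. (case z of (t, K) \<Rightarrow> measure lborel K *\<^sub>R g0 t - (F (Sup K) - F (Inf K))))
          \<le> (\<Sum>z\<in>p - q. (case z of (t, K) \<Rightarrow> e' * (Sup K - Inf K)))"
      proof (rule sum_norm_le, safe)
        fix t K assume tK: "(t, K) \<in> p" "(t, K) \<notin> q"
        obtain u v where uv: "K = {u..v}" "u \<le> v" "t \<in> K" "c \<le> u" "v \<le> d" using box[OF tK(1)] by blast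
        have t: "t \<in> {c..d} - N" using uv tK by (auto simp: q_def)
        have sub: "K \<subseteq> ball t (r t)" using fineD[OF fine tK(1)] t by (auto simp: \<gamma>_def)
        have "u \<in> K" "v \<in> K" using uv by auto
        then have "u \<in> ball t (r t)" "v \<in> ball t (r t)"
          using sub by blast+
        then have "\<bar>u - t\<bar> < r t" "\<bar>v - t\<bar> < r t"
          by (simp_all add: dist_real_def abs_minus_commute)
        then have b: "cmod (F u - F t - (u - t) *\<^sub>R g t) \<le> e' * \<bar>u - t\<bar>"
          "cmod (F v - F t - (v - t) *\<^sub>R g t) \<le> e' * \<bar>v - t\<bar>"
          using r(2)[OF t, of u] r(2)[OF t, of v] uv by simp_all
        have "cmod (measure lborel K *\<^sub>R g0 t - (F (Sup K) - F (Inf K)))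
            = cmod ((F u - F t - (u - t) *\<^sub>R g t) - (F v - F t - (v - t) *\<^sub>R g t))"
          using uv t by (simp add: g0_def algebra_simps)
        also have "\<dots> \<le> e' * \<bar>u - t\<bar> + e' * \<bar>v - t\<bar>"
          using norm_triangle_ineq4 b by (meson add_mono order_trans)
        also have "\<dots> = e' * (Sup K - Inf K)"
          using uv by (auto simp: algebra_simps)
        finally show "cmod (measure lborel K *\<^sub>R g0 t - (F (Sup K) - F (Inf K))) \<le> e' * (Sup K - Inf K)" .
      qed
      also have "\<dots> \<le> (\<Sum>z\<in>p. (case z of (t, K) \<Rightarrow> e' * (Sup K - Inf K)))"
        using e'(1) by (intro sum_mono2 fin) (auto dest!: box)
      also have "\<dots> = e' * (d - c)"
        unfolding sumI by (simp add: sum_distrib_left case_prod_unfold)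
      finally have good: "cmod (\<Sum>z\<in>p - q. (case z of (t, K) \<Rightarrow> measure lborel K *\<^sub>R g0 t - (F (Sup K) - F (Inf K))))
          < e / 2" using e'(2) by linarith
      have qtag: "q tagged_division_of \<Union>(snd ` q)"
        using tagged_partial_division_subset[OF _ q] ptag tagged_partial_division_of_Union_self
          tagged_division_of_def by blast
      define D where "D = snd ` q"
      have D: "D division_of \<Union>D"
        unfolding D_def using division_of_tagged_division[OF qtag] .
      have Dbox: "\<exists>u v. K = {u..v} \<and> u \<le> v \<and> c \<le> u \<and> v \<le> d" if "K \<in> D" for K
        using that box q unfolding D_def by fastforce
      have "(\<Sum>K\<in>D. Sup K - Inf K) = (\<Sum>K\<in>D. measure lebesgue K)"
        by (intro sum.cong refl) (auto dest!: Dbox)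
      also have "\<dots> = measure lebesgue (\<Union>D)"
        using content_division[OF D] .
      also have "\<dots> \<le> measure lebesgue U"
      proof (rule measure_mono_fmeasurable)
        show "\<Union>D \<subseteq> U"
          using fine unfolding D_def q_def fine_def \<gamma>_def by fastforce
        show "\<Union>D \<in> sets lebesgue"
          using D by (meson fmeasurableD lmeasurable_division)
      qed (rule U)
      finally have "(\<Sum>K\<in>D. Sup K - Inf K) < \<delta>" using U by simp
      moreover have "\<Union>D \<subseteq> {c..d}" by (auto dest!: Dbox)
      ultimately have bad: "(\<Sum>K\<in>D. cmod (F (Sup K) - F (Inf K))) < e / 2"
        using AC\<delta>[THEN spec, THEN mp, OF conjI[OF D conjI]] by blast
      have "cmod (\<Sum>z\<in>q. (case z of (t, K) \<Rightarrow> measure lborel K *\<^sub>R g0 t - (F (Sup K) - F (Inf K))))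
         \<le> (\<Sum>z\<in>q. (case z of (t, K) \<Rightarrow> cmod (F (Sup K) - F (Inf K))))"
        by (rule sum_norm_le) (auto simp: q_def g0_def norm_minus_commute)
      also have "\<dots> = (\<Sum>z\<in>q. cmod (F (Sup (snd z)) - F (Inf (snd z))))"
        by (simp add: case_prod_unfold)
      also have "\<dots> = (\<Sum>K\<in>D. cmod (F (Sup K) - F (Inf K)))"
        unfolding D_def
      proof (rule sum.reindex_nontrivial[symmetric, unfolded o_def])
        show "finite q" using fin q finite_subset by blast
        fix z z' assume zz: "z \<in> q" "z' \<in> q" "z \<noteq> z'" "snd z = snd z'"
        obtain t t' K where z: "z = (t, K)" "z' = (t', K)" using zz(4) by (metis prod.collapse)
        \<comment> \<open>One interval can carry two tags only if it is degenerate, and then its increment vanishes.\<close>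
        have "interior K \<inter> interior K = {}"
          using tagged_division_ofD(5)[OF ptag, of t K t' K] zz q z by auto
        moreover obtain u v where "K = {u..v}" "u \<le> v" using box[of t K] zz(1) q z by blast
        ultimately show "cmod (F (Sup (snd z)) - F (Inf (snd z))) = 0" using z by simp
      qed
      finally have "cmod (\<Sum>z\<in>q. (case z of (t, K) \<Rightarrow> measure lborel K *\<^sub>R g0 t - (F (Sup K) - F (Inf K)))) < e / 2"
        using bad by simp
      with good have "cmod ((\<Sum>z\<in>p - q. (case z of (t, K) \<Rightarrow> measure lborel K *\<^sub>R g0 t - (F (Sup K) - F (Inf K))))
         + (\<Sum>z\<in>q. (case z of (t, K) \<Rightarrow> measure lborel K *\<^sub>R g0 t - (F (Sup K) - F (Inf K))))) < e"
        by norm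
      also have "(\<Sum>z\<in>p - q. (case z of (t, K) \<Rightarrow> measure lborel K *\<^sub>R g0 t - (F (Sup K) - F (Inf K))))
         + (\<Sum>z\<in>q. (case z of (t, K) \<Rightarrow> measure lborel K *\<^sub>R g0 t - (F (Sup K) - F (Inf K))))
         = (\<Sum>(t, K)\<in>p. measure lborel K *\<^sub>R g0 t) - (F d - F c)"
        unfolding sumF sum.subset_diff[OF q fin, symmetric]
        by (simp add: sum_subtractf case_prod_unfold)
      finally show ?thesis .
    qed
    show "\<exists>\<gamma>. gauge \<gamma> \<and> (\<forall>p. p tagged_division_of cbox c d \<and> \<gamma> fine p \<longrightarrow>
        cmod ((\<Sum>(t, K)\<in>p. measure lborel K *\<^sub>R g0 t) - (F d - F c)) < e)"
      by (intro exI[of _ \<gamma>] conjI gauge allI impI est) (elim conjE, assumption)+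
  qed
  then have "(g0 has_integral (F d - F c)) {c..d}" by simp
  then show ?thesis
    by (rule has_integral_spike[OF N, rotated]) (simp add: g0_def)
qed

section \<open>Lines in an infinite product of continuous probability measures\<close>

text \<open>Fubini in the coordinate \<open>n\<close>. The points of \<open>B\<close> whose line in direction \<open>n\<close> meets \<open>B\<close> in a
\<open>p n\<close>-null set form a null set \<open>N\<close>, since every line meets \<open>N\<close> in a null set. Any other point of \<open>B\<close> lies on a
line that meets \<open>B\<close> in a set of positive measure, and such a set is not a single point.\<close>

lemma AE_PiM_other_point_on_line:
  fixes p :: "'i \<Rightarrow> real measure"
  assumes prob: "\<And>n. n \<in> I \<Longrightarrow> prob_space (p n)"
    and sets_p: "\<And>n. n \<in> I \<Longrightarrow> sets (p n) = sets borel"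
    and atomless: "\<And>r. emeasure (p n) {r} = 0"
    and n: "n \<in> I" and B: "B \<in> sets (PiM I p)"
  shows "AE w in PiM I p. w \<in> B \<longrightarrow> (\<exists>r. r \<noteq> w n \<and> w(n := r) \<in> B)"
proof -
  define J where "J = I - {n}"
  have I: "I = insert n J" using n by (auto simp: J_def)
  interpret pn: prob_space "p n" using prob n by simp
  interpret PJ: prob_space "PiM J p" using prob by (intro prob_space_PiM) (auto simp: J_def)
  interpret PP: pair_sigma_finite "p n" "PiM J p" ..
  define s where "s w = emeasure (p n) {r \<in> space (p n). w(n := r) \<in> B}" for w
  have upd[measurable]: "(\<lambda>(r, w). w(n := r)) \<in> (p n \<Otimes>\<^sub>M PiM J p) \<rightarrow>\<^sub>M PiM I p"
    unfolding I by measurable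
  have updI: "(\<lambda>(w, r). w(n := r)) \<in> (PiM I p \<Otimes>\<^sub>M p n) \<rightarrow>\<^sub>M PiM I p"
  proof -
    have "(\<lambda>(w, r). w(n := r)) \<in> (PiM I p \<Otimes>\<^sub>M p n) \<rightarrow>\<^sub>M PiM (insert n I) p"
      by (intro measurable_add_dim)
    then show ?thesis using n by (simp add: insert_absorb)
  qed
  have smeas: "s \<in> borel_measurable (PiM I p)"
  proof -
    have "(\<lambda>(w, r). indicator B (w(n := r)) :: ennreal) \<in> borel_measurable (PiM I p \<Otimes>\<^sub>M p n)"
      using measurable_compose[OF updI borel_measurable_indicator[OF B]] by (simp add: case_prod_unfold)
    from pn.borel_measurable_nn_integral[OF this]
    have "(\<lambda>w. \<integral>\<^sup>+ r. indicator B (w(n := r)) \<partial>p n) \<in> borel_measurable (PiM I p)" by simp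
    moreover have "(\<integral>\<^sup>+ r. indicator B (w(n := r)) \<partial>p n) = s w" if "w \<in> space (PiM I p)" for w
    proof -
      have "(\<lambda>r. w(n := r)) \<in> p n \<rightarrow>\<^sub>M PiM I p"
        using measurable_compose[OF measurable_Pair1'[OF that] updI] by simp
      from measurable_sets[OF this B] have "{r \<in> space (p n). w(n := r) \<in> B} \<in> sets (p n)"
        by (simp add: vimage_def Int_def conj_commute)
      note ind = nn_integral_indicator[OF this]
      have "(\<integral>\<^sup>+ r. indicator B (w(n := r)) \<partial>p n) = (\<integral>\<^sup>+ r. indicator {r \<in> space (p n). w(n := r) \<in> B} r \<partial>p n)"
        by (intro nn_integral_cong) (auto simp: indicator_def)
      also have "\<dots> = s w" using ind unfolding s_def by simp
      finally show ?thesis .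
    qed
    ultimately show ?thesis by (subst measurable_cong[where g="\<lambda>w. \<integral>\<^sup>+ r. indicator B (w(n := r)) \<partial>p n"]) auto
  qed
  define N where "N = {w \<in> space (PiM I p). w \<in> B \<and> s w = 0}"
  have N: "N \<in> sets (PiM I p)" unfolding N_def using smeas B by measurable
  \<comment> \<open>The section measure is constant along the lines in direction \<open>n\<close>, so such a line meets \<open>N\<close> either
    in all its points of \<open>B\<close>, which are then negligible, or not at all.\<close>
  have s_upd: "s (w(n := r)) = s w" for w r by (simp add: s_def)
  have "emeasure (PiM I p) N = emeasure (distr (p n \<Otimes>\<^sub>M PiM J p) (PiM I p) (\<lambda>(r, w). w(n := r))) N"
    unfolding I using prob by (subst distr_pair_PiM_eq_PiM) (auto simp: I)
  also have "\<dots> = (\<integral>\<^sup>+ z. indicator N (case z of (r, w) \<Rightarrow> w(n := r)) \<partial>(p n \<Otimes>\<^sub>M PiM J p))"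
    using N by (subst nn_integral_distr[OF upd, symmetric]) simp_all
  also have "\<dots> = (\<integral>\<^sup>+ w. (\<integral>\<^sup>+ r. indicator N (w(n := r)) \<partial>p n) \<partial>PiM J p)"
    using N by (subst PP.nn_integral_snd[symmetric]) (auto intro!: measurable_compose[OF upd borel_measurable_indicator])
  also have "\<dots> = (\<integral>\<^sup>+ w. 0 \<partial>PiM J p)"
  proof (rule nn_integral_cong)
    fix w assume "w \<in> space (PiM J p)"
    have "(\<integral>\<^sup>+ r. indicator N (w(n := r)) \<partial>p n) \<le> (if s w = 0 then s w else 0)"
    proof (cases "s w = 0")
      case True
      have "{r \<in> space (p n). w(n := r) \<in> B} \<in> sets (p n)"
      proof -
        have "(\<lambda>r. w(n := r)) \<in> p n \<rightarrow>\<^sub>M PiM I p"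
          using measurable_compose[OF measurable_Pair2'[OF \<open>w \<in> _\<close>] upd] by simp
        from measurable_sets[OF this B] show ?thesis
          by (simp add: vimage_def Int_def conj_commute)
      qed
      then have "s w = (\<integral>\<^sup>+ r. indicator {r \<in> space (p n). w(n := r) \<in> B} r \<partial>p n)"
        by (simp add: s_def)
      moreover have "(\<integral>\<^sup>+ r. indicator N (w(n := r)) \<partial>p n) \<le> \<dots>"
        by (rule nn_integral_mono) (auto simp: N_def indicator_def)
      ultimately show ?thesis using True by simp
    next
      case False
      then have "indicator N (w(n := r)) = (0 :: ennreal)" for r by (simp add: N_def s_upd)
      then show ?thesis by simp
    qed
    then show "(\<integral>\<^sup>+ r. indicator N (w(n := r)) \<partial>p n) = 0" by (simp split: if_splits)
  qed
  finally have "N \<in> null_sets (PiM I p)" using N by auto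
  then have "AE w in PiM I p. w \<notin> N" by (rule AE_not_in)
  then show ?thesis
  proof eventually_elim
    case (elim w)
    show ?case
    proof (intro impI, rule ccontr)
      assume "w \<in> B" "\<nexists>r. r \<noteq> w n \<and> w(n := r) \<in> B"
      then have "{r \<in> space (p n). w(n := r) \<in> B} \<subseteq> {w n}" by auto
      then have "s w \<le> emeasure (p n) {w n}"
        unfolding s_def by (rule emeasure_mono) (simp add: sets_p[OF n])
      then have "s w = 0" by (simp add: atomless)
      moreover have "w \<in> space (PiM I p)" using \<open>w \<in> B\<close> B sets.sets_into_space by blast
      ultimately show False using elim \<open>w \<in> B\<close> by (simp add: N_def)
    qed
  qed
qed

text \<open>Countably many exceptional null sets cannot exhaust a set of positive measure. It is \<open>B\<close> that is cut
by lines, not a larger set known only to be a union of thin sets: a set that meets lines in single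
points need not be measurable, so nothing could be said about its measure.\<close>

lemma ex_point_with_other_points_on_all_lines:
  fixes p :: "'i \<Rightarrow> real measure"
  assumes I: "countable I"
    and prob: "\<And>n. n \<in> I \<Longrightarrow> prob_space (p n)"
    and sets_p: "\<And>n. n \<in> I \<Longrightarrow> sets (p n) = sets borel"
    and atomless: "\<And>n r. n \<in> I \<Longrightarrow> emeasure (p n) {r} = 0"
    and B: "B \<in> sets (completion (PiM I p))" and pos: "emeasure (completion (PiM I p)) B \<noteq> 0"
  shows "\<exists>w\<in>B. \<forall>n\<in>I. \<exists>r. r \<noteq> w n \<and> w(n := r) \<in> B"
proof -
  \<comment> \<open>Up to a null set, \<open>B\<close> is measurable before completion, where Fubini applies.\<close>
  define B' where "B' = main_part (PiM I p) B"
  have "B' \<subseteq> B" using main_part_null_part_Un[OF B] unfolding B'_def by blast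
  moreover have "B' \<in> sets (PiM I p)" "emeasure (PiM I p) B' \<noteq> 0"
    using B pos by (auto simp: B'_def main_part_sets)
  ultimately have B': "B' \<in> sets (PiM I p)" "B' \<subseteq> B" "emeasure (PiM I p) B' \<noteq> 0"
    by blast+
  have "AE w in PiM I p. \<forall>n\<in>I. w \<in> B' \<longrightarrow> (\<exists>r. r \<noteq> w n \<and> w(n := r) \<in> B')"
    using I by (rule AE_ball_countable[THEN iffD2]) (auto intro!: AE_PiM_other_point_on_line assms B')
  note AE = this
  have "\<exists>w\<in>B'. \<forall>n\<in>I. \<exists>r. r \<noteq> w n \<and> w(n := r) \<in> B'"
  proof (rule ccontr)
    assume none: "\<not> ?thesis"
    from AE have "AE w in PiM I p. w \<notin> B'" by (rule eventually_mono) (use none in blast)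
    then have "B' \<in> null_sets (PiM I p)" using B'(1) by (simp add: AE_iff_null_sets)
    with B'(3) show False by auto
  qed
  then show ?thesis using B' by blast
qed

section \<open>Solutions and their Wronskian\<close>

lemma mem_einterval_convex:
  "c \<in> einterval a b \<Longrightarrow> d \<in> einterval a b \<Longrightarrow> {c..d} \<subseteq> einterval a b"
  by (auto simp: einterval_def) (meson ereal_less_eq(3) order_less_le_trans order_le_less_trans)+

lemma connected_einterval: "connected (einterval a b)"
proof (rule is_interval_connected)
  show "is_interval (einterval a b)"
    unfolding is_interval_1 using mem_einterval_convex[of _ a b] by (meson atLeastAtMost_iff subsetD)
qed

lemma delta_expr_AE_cong:
  assumes "delta_expr a b V I x w f g" "AE y in lebesgue_on (einterval a b). g y = g' y"
  shows "delta_expr a b V I x w f g'"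
  using assms unfolding delta_expr_def by (auto elim!: AE_mp)

lemma is_solution_subinterval:
  assumes sol: "is_solution a b V I x w z f" and sub: "einterval a' b' \<subseteq> einterval a b"
    and I': "I' = {k \<in> I. x k \<in> einterval a' b'}" and w: "\<And>k. k \<in> I' \<Longrightarrow> w' k = w k"
  shows "is_solution a' b' V I' x w' z f"
proof -
  have S: "einterval a' b' - x ` I' \<subseteq> einterval a b - x ` I" using sub I' by auto
  note sol = sol[unfolded is_solution_def delta_expr_def]
  have "loc_abs_continuous_on (einterval a' b' - x ` I') f"
    "loc_abs_continuous_on (einterval a' b' - x ` I') (vderiv f)"
    using sol S unfolding loc_abs_continuous_on_def by (meson order_trans)+
  moreover have "\<forall>y \<in> einterval a' b' - x ` I'. f differentiable (at y)" using sol S by blast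
  moreover have "AE y in lebesgue_on (einterval a' b').
        (vderiv f has_vector_derivative (complex_of_real (V y) * f y - z * f y)) (at y)"
  proof -
    have "einterval a b \<in> sets lebesgue" "einterval a' b' \<in> sets lebesgue" by auto
    then show ?thesis using sol sub by (auto simp: AE_restrict_space_iff elim!: AE_mp)
  qed
  moreover have "delta_conditions I' x w' f"
    using sol w I' unfolding delta_conditions_def by simp
  ultimately show ?thesis unfolding is_solution_def delta_expr_def by blast
qed

definition wronskian :: "(real \<Rightarrow> complex) \<Rightarrow> (real \<Rightarrow> complex) \<Rightarrow> real \<Rightarrow> complex" where
  "wronskian f g y = f y * vderiv g y - vderiv f y * g y"

text \<open>The data of the differential expression apart from the coupling constants. The hypotheses pass to
subintervals; the Wronskian argument is run on the two intervals into which one interaction point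
divides \<open>(a, b)\<close>.\<close>

locale delta_interactions =
  fixes a b :: ereal and V :: "real \<Rightarrow> real" and I :: "int set" and x :: "int \<Rightarrow> real"
  assumes V_loc: "L1_loc (einterval a b) V"
    and x_inj: "inj_on x I"
    and x_in: "x ` I \<subseteq> einterval a b"
    and x_discrete: "\<And>y. y \<in> einterval a b \<Longrightarrow> \<not> y islimpt x ` I"
begin

abbreviation "J \<equiv> einterval a b"
abbreviation "M \<equiv> x ` I"
abbreviation "sol \<equiv> is_solution a b V I x"

lemma isolating_neighbourhood:
  assumes "t \<in> J"
  obtains r where "r > 0" "{t - r..t + r} \<subseteq> J" "{t - r..t + r} \<inter> M \<subseteq> {t}"
proof -
  obtain r1 where r1: "r1 > 0" "ball t r1 \<subseteq> J"
    using assms open_einterval open_contains_ball by blast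
  have "\<forall>\<^sub>F y in at t. y \<notin> M" using x_discrete[OF assms] by (simp add: islimpt_iff_eventually)
  then obtain r2 where r2: "r2 > 0" "\<And>y. y \<noteq> t \<Longrightarrow> dist y t < r2 \<Longrightarrow> y \<notin> M"
    unfolding eventually_at by blast
  define r where "r = min r1 r2 / 2"
  have "{t - r..t + r} \<subseteq> ball t r1" "{t - r..t + r} \<subseteq> ball t r2" "r > 0"
    using r1 r2 by (auto simp: r_def dist_real_def)
  moreover have "y = t" if "y \<in> ball t r2" "y \<in> M" for y
    using r2(2)[of y] that by (auto simp: dist_commute)
  ultimately show thesis
    using r1(2) by (intro that[of r]) blast+
qed

lemma J_minus_M_interior:
  assumes "t \<in> J - M"
  obtains r where "r > 0" "{t - r..t + r} \<subseteq> J - M"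
proof -
  obtain r where r: "r > 0" "{t - r..t + r} \<subseteq> J" "{t - r..t + r} \<inter> M \<subseteq> {t}"
    using isolating_neighbourhood[of t] assms by blast
  then have "{t - r..t + r} \<subseteq> J - M" using assms by blast
  with r(1) show thesis by (rule that)
qed

lemma solution_derivs:
  assumes "sol w z f" and t: "t \<in> J - M"
  shows "(f has_vector_derivative vderiv f t) (at t)" "isCont f t" "isCont (vderiv f) t"
proof -
  note s = assms(1)[unfolded is_solution_def delta_expr_def]
  have "f differentiable (at t)" using s t by blast
  then show "(f has_vector_derivative vderiv f t) (at t)" "isCont f t"
    by (auto simp: vector_derivative_works differentiable_imp_continuous_within)
  obtain r where r: "r > 0" "{t - r..t + r} \<subseteq> J - M" using J_minus_M_interior[OF t] .
  then have "abs_continuous_on {t - r..t + r} (vderiv f)"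
    using s unfolding loc_abs_continuous_on_def by auto
  then have "continuous_on {t - r..t + r} (vderiv f)" by (rule abs_continuous_on_imp_continuous_on)
  then show "isCont (vderiv f) t" using r(1) by (intro continuous_on_interior) auto
qed

lemma solution_AE:
  assumes "sol w z f"
  obtains N where "negligible N"
    "\<forall>y\<in>J - N. (vderiv f has_vector_derivative ((complex_of_real (V y) - z) * f y)) (at y)"
proof -
  have "AE y in lebesgue_on J. (vderiv f has_vector_derivative (complex_of_real (V y) * f y - z * f y)) (at y)"
    using assms unfolding is_solution_def delta_expr_def by blast
  then have "AE y in lebesgue. y \<in> J \<longrightarrow> (vderiv f has_vector_derivative ((complex_of_real (V y) - z) * f y)) (at y)"
    by (subst (asm) AE_restrict_space_iff) (auto simp: algebra_simps)
  then obtain N where "N \<in> null_sets lebesgue" "{y \<in> space lebesgue. \<not> (y \<in> J \<longrightarrow> (vderiv f has_vector_derivative ((complex_of_real (V y) - z) * f y)) (at y))} \<subseteq> N"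
    by (elim AE_E3) auto
  then show thesis by (intro that[of N]) (auto simp: negligible_iff_null_sets)
qed

lemma solution_abs_continuous:
  assumes "sol w z f" "c \<le> d" "{c..d} \<subseteq> J - M"
  shows "abs_continuous_on {c..d} f" "abs_continuous_on {c..d} (vderiv f)"
  using assms unfolding is_solution_def delta_expr_def loc_abs_continuous_on_def by auto

lemma solution_has_integral:
  assumes f: "sol w z f" and cd: "c \<le> d" "{c..d} \<subseteq> J - M"
  shows "(vderiv f has_integral f d - f c) {c..d}"
    and "((\<lambda>y. (complex_of_real (V y) - z) * f y) has_integral vderiv f d - vderiv f c) {c..d}"
proof -
  show "(vderiv f has_integral f d - f c) {c..d}"
  proof (rule fundamental_theorem_of_calculus[OF cd(1)])
    fix y assume "y \<in> {c..d}"
    then have "y \<in> J - M" using cd(2) by blast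
    then show "(f has_vector_derivative vderiv f y) (at y within {c..d})"
      by (rule has_vector_derivative_at_within[OF solution_derivs(1)[OF f]])
  qed
  obtain N where N: "negligible N"
    "\<forall>y\<in>J - N. (vderiv f has_vector_derivative ((complex_of_real (V y) - z) * f y)) (at y)"
    using solution_AE[OF f] .
  show "((\<lambda>y. (complex_of_real (V y) - z) * f y) has_integral vderiv f d - vderiv f c) {c..d}"
  proof (rule abs_continuous_on_has_integral[OF cd(1) solution_abs_continuous(2)[OF f cd] N(1)])
    fix y assume "y \<in> {c..d} - N"
    then have "y \<in> J - N" using cd(2) by blast
    then show "(vderiv f has_vector_derivative (complex_of_real (V y) - z) * f y) (at y within {c..d})"
      by (rule has_vector_derivative_at_within[OF N(2)[THEN bspec]])
  qed
qed

text \<open>The Wronskian is a combination of products of absolutely continuous functions and its derivative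
\<open>f g'' - f'' g\<close> vanishes wherever both equations hold, hence almost everywhere.\<close>

lemma wronskian_const_off_M:
  assumes f: "sol w z f" and g: "sol w z g" and cd: "c \<le> d" "{c..d} \<subseteq> J - M"
  shows "wronskian f g c = wronskian f g d"
proof -
  obtain N1 where N1: "negligible N1"
    "\<forall>y\<in>J - N1. (vderiv f has_vector_derivative ((complex_of_real (V y) - z) * f y)) (at y)"
    using solution_AE[OF f] .
  obtain N2 where N2: "negligible N2"
    "\<forall>y\<in>J - N2. (vderiv g has_vector_derivative ((complex_of_real (V y) - z) * g y)) (at y)"
    using solution_AE[OF g] .
  have "abs_continuous_on {c..d} (wronskian f g)"
    unfolding wronskian_def
    by (intro abs_continuous_on_diff abs_continuous_on_mult solution_abs_continuous[OF f cd] solution_abs_continuous[OF g cd])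
  moreover have "(wronskian f g has_vector_derivative 0) (at y within {c..d})" if "y \<in> {c..d} - (N1 \<union> N2)" for y
  proof -
    have y: "y \<in> J - M" "y \<in> J - N1" "y \<in> J - N2" using that cd by auto
    have "((\<lambda>y. f y * vderiv g y - vderiv f y * g y) has_vector_derivative
       (f y * ((complex_of_real (V y) - z) * g y) + vderiv f y * vderiv g y)
        - (vderiv f y * vderiv g y + ((complex_of_real (V y) - z) * f y) * g y)) (at y)"
      by (intro has_vector_derivative_diff has_vector_derivative_mult solution_derivs(1)[OF f y(1)]
          solution_derivs(1)[OF g y(1)] N1(2)[THEN bspec, OF y(2)] N2(2)[THEN bspec, OF y(3)])
    then have "(wronskian f g has_vector_derivative 0) (at y)"
      by (simp add: wronskian_def[abs_def] algebra_simps)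
    then show ?thesis by (rule has_vector_derivative_at_within)
  qed
  ultimately have zero: "((\<lambda>_. 0) has_integral (wronskian f g d - wronskian f g c)) {c..d}"
    by (rule abs_continuous_on_has_integral[OF cd(1) _ negligible_Un[OF N1(1) N2(1)]])
  show ?thesis using has_integral_unique[OF zero has_integral_0] by simp
qed

text \<open>A sum of at most one term: the coupling constant at an interaction point and 0 at any other point.
The jump condition of a solution then has one form at all points of the interval.\<close>

definition strength :: "(int \<Rightarrow> real) \<Rightarrow> real \<Rightarrow> real" where
  "strength w t = (\<Sum>n | n \<in> I \<and> x n = t. w n)"

lemma strength_x: "n \<in> I \<Longrightarrow> strength w (x n) = w n"
proof -
  assume "n \<in> I"
  then have "{k. k \<in> I \<and> x k = x n} = {n}" using x_inj by (auto simp: inj_on_def)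
  then show ?thesis by (simp add: strength_def)
qed

lemma solution_limits:
  assumes f: "sol w z f" and t: "t \<in> J"
  obtains l dl dr where "(f \<longlongrightarrow> l) (at_left t)" "(f \<longlongrightarrow> l) (at_right t)"
    "(vderiv f \<longlongrightarrow> dl) (at_left t)" "(vderiv f \<longlongrightarrow> dr) (at_right t)"
    "dr - dl = complex_of_real (strength w t) * l"
proof (cases "t \<in> M")
  case True
  then obtain n where n: "n \<in> I" "t = x n" by blast
  have "delta_conditions I x w f" using f unfolding is_solution_def delta_expr_def by blast
  from this[unfolded delta_conditions_def, THEN bspec, OF n(1)] show thesis
    unfolding n(2) strength_x[OF n(1), of w, symmetric] by (elim exE conjE) (rule that, unfold n(2))
next
  case False
  then have s: "strength w t = 0" unfolding strength_def by (intro sum.neutral) auto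
  have "isCont f t" "isCont (vderiv f) t" using solution_derivs[OF f] t False by auto
  then have "(f \<longlongrightarrow> f t) (at t)" "(vderiv f \<longlongrightarrow> vderiv f t) (at t)"
    by (auto simp: isCont_def)
  then show thesis using s by (intro that[of "f t" "vderiv f t" "vderiv f t"]) (auto simp: filterlim_at_split)
qed

text \<open>The Wronskian does not jump at an interaction point: both derivatives jump by the same multiple of
the function value, and these contributions cancel.\<close>

lemma wronskian_locally_const:
  assumes f: "sol w z f" and g: "sol w z g" and t: "t \<in> J"
  obtains r c where "r > 0" "{t - r<..<t + r} \<subseteq> J"
    "\<forall>y\<in>{t - r<..<t + r} - M. wronskian f g y = c"
proof -
  obtain r where r: "r > 0" "{t - r..t + r} \<subseteq> J" "{t - r..t + r} \<inter> M \<subseteq> {t}"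
    using isolating_neighbourhood[OF t] .
  show thesis
  proof (cases "t \<in> M")
    case False
    then have off: "{t - r..t + r} \<subseteq> J - M" using r(2,3) by blast
    have "wronskian f g y = wronskian f g t" if y: "y \<in> {t - r<..<t + r} - M" for y
    proof (cases "y \<le> t")
      case True
      have "{y..t} \<subseteq> {t - r..t + r}" using y r(1) by auto
      then have "{y..t} \<subseteq> J - M" using off by blast
      with True show ?thesis by (intro wronskian_const_off_M[OF f g])
    next
      case False
      have "{t..y} \<subseteq> {t - r..t + r}" using y r(1) by auto
      then have "{t..y} \<subseteq> J - M" using off by blast
      with False show ?thesis by (intro wronskian_const_off_M[OF f g, symmetric]) simp_all
    qed
    with r show thesis by (intro that[of r "wronskian f g t"]) (auto simp: subset_iff)
  next
    case True
    let ?W = "wronskian f g"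
    have left: "?W y = ?W (t - r)" if y: "y \<in> {t - r<..<t}" for y
    proof -
      have "{t - r..y} \<subseteq> {t - r..t + r} - {t}" using y r(1) by auto
      then have "{t - r..y} \<subseteq> J - M" using r(2,3) by blast
      with y show ?thesis by (intro wronskian_const_off_M[OF f g, symmetric]) simp_all
    qed
    have right: "?W y = ?W (t + r)" if y: "y \<in> {t<..<t + r}" for y
    proof -
      have "{y..t + r} \<subseteq> {t - r..t + r} - {t}" using y r(1) by auto
      then have "{y..t + r} \<subseteq> J - M" using r(2,3) by blast
      with y show ?thesis by (intro wronskian_const_off_M[OF f g]) simp_all
    qed
    obtain l dl dr where l: "(f \<longlongrightarrow> l) (at_left t)" "(f \<longlongrightarrow> l) (at_right t)"
      "(vderiv f \<longlongrightarrow> dl) (at_left t)" "(vderiv f \<longlongrightarrow> dr) (at_right t)"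
      "dr - dl = complex_of_real (strength w t) * l" using solution_limits[OF f t] .
    obtain l' dl' dr' where l': "(g \<longlongrightarrow> l') (at_left t)" "(g \<longlongrightarrow> l') (at_right t)"
      "(vderiv g \<longlongrightarrow> dl') (at_left t)" "(vderiv g \<longlongrightarrow> dr') (at_right t)"
      "dr' - dl' = complex_of_real (strength w t) * l'" using solution_limits[OF g t] .
    have "(?W \<longlongrightarrow> l * dl' - dl * l') (at_left t)" "(?W \<longlongrightarrow> l * dr' - dr * l') (at_right t)"
      unfolding wronskian_def using l l' by (auto intro!: tendsto_intros)
    moreover have "\<forall>\<^sub>F y in at_left t. ?W y = ?W (t - r)"
      using left r(1) unfolding eventually_at_left_field by (intro exI[of _ "t - r"]) auto
    then have "(?W \<longlongrightarrow> ?W (t - r)) (at_left t)" by (rule tendsto_eventually)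
    moreover have "\<forall>\<^sub>F y in at_right t. ?W y = ?W (t + r)"
      using right r(1) unfolding eventually_at_right_field by (intro exI[of _ "t + r"]) auto
    then have "(?W \<longlongrightarrow> ?W (t + r)) (at_right t)" by (rule tendsto_eventually)
    ultimately have "?W (t - r) = l * dl' - dl * l'" "?W (t + r) = l * dr' - dr * l'"
      by (auto intro: tendsto_unique[rotated])
    moreover
    have "dr' = dl' + complex_of_real (strength w t) * l'" "dr = dl + complex_of_real (strength w t) * l"
      using l(5) l'(5) by (auto simp: algebra_simps)
    then have "l * dr' - dr * l' = l * dl' - dl * l'" by (simp add: algebra_simps)
    ultimately have eq: "?W (t + r) = ?W (t - r)" by simp
    have "?W y = ?W (t - r)" if "y \<in> {t - r<..<t + r} - M" for y
      using left[of y] right[of y] that True eq by (cases y t rule: linorder_cases) auto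
    with r show thesis by (intro that[of r "?W (t - r)"]) (auto simp: subset_iff)
  qed
qed

text \<open>Local constancy and connectedness. The Wronskian is not controlled at the points of \<open>M\<close> themselves,
so the property that spreads over the interval speaks of punctured neighbourhoods.\<close>

lemma wronskian_const:
  assumes f: "sol w z f" and g: "sol w z g"
  obtains c where "\<And>y. y \<in> J - M \<Longrightarrow> wronskian f g y = c"
proof (cases "J - M = {}")
  case True
  then show thesis using that[of 0] by blast
next
  case False
  then obtain y0 where y0: "y0 \<in> J - M" by blast
  define P where "P t \<longleftrightarrow> (\<forall>\<^sub>F y in at t. wronskian f g y = wronskian f g y0)" for t
  have near: "(P s \<longleftrightarrow> c = wronskian f g y0)"
    if "s \<in> {t - r<..<t + r}" "{t - r<..<t + r} \<subseteq> J" "\<forall>y\<in>{t - r<..<t + r} - M. wronskian f g y = c" for s t r c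
  proof -
    have "\<forall>\<^sub>F y in at s. y \<notin> M"
      using x_discrete[of s] that by (auto simp: islimpt_iff_eventually)
    moreover have "\<forall>\<^sub>F y in at s. y \<in> {t - r<..<t + r}"
      using that(1) by (intro eventually_at_in_open') auto
    ultimately have ev: "\<forall>\<^sub>F y in at s. wronskian f g y = c"
      by eventually_elim (use that in auto)
    show ?thesis
    proof
      assume "P s"
      with ev have "\<forall>\<^sub>F y in at s. c = wronskian f g y0" unfolding P_def by eventually_elim simp
      then show "c = wronskian f g y0" by simp
    qed (use ev in \<open>simp add: P_def\<close>)
  qed
  have P0: "P y0"
  proof -
    obtain r c where r: "r > 0" "{y0 - r<..<y0 + r} \<subseteq> J"
      "\<forall>y\<in>{y0 - r<..<y0 + r} - M. wronskian f g y = c"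
      using wronskian_locally_const[OF f g, of y0] y0 by blast
    then show ?thesis using near[of y0 y0 r c] y0 r(3) by auto
  qed
  have P: "P t" if "t \<in> J" for t
  proof (rule connected_induction_simple[OF connected_einterval _ that, of y0 P])
    fix s assume "s \<in> J"
    obtain r c where r: "r > 0" "{s - r<..<s + r} \<subseteq> J"
      "\<forall>y\<in>{s - r<..<s + r} - M. wronskian f g y = c"
      using wronskian_locally_const[OF f g \<open>s \<in> J\<close>] .
    show "\<exists>T. openin (top_of_set J) T \<and> s \<in> T \<and> (\<forall>x\<in>T. \<forall>y\<in>T. P x \<longrightarrow> P y)"
    proof (intro exI conjI ballI impI)
      show "openin (top_of_set J) {s - r<..<s + r}" using r by (simp add: openin_open_eq)
      show "s \<in> {s - r<..<s + r}" using r by simp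
    qed (use near[OF _ r(2,3)] in blast)
  qed (use y0 P0 in auto)
  show thesis
  proof (rule that)
    fix t assume t: "t \<in> J - M"
    obtain r c where r: "r > 0" "{t - r<..<t + r} \<subseteq> J"
      "\<forall>y\<in>{t - r<..<t + r} - M. wronskian f g y = c"
      using wronskian_locally_const[OF f g, of t] t by blast
    then show "wronskian f g t = wronskian f g y0"
      using near[OF _ r(2,3), of t] P[of t] t by auto
  qed
qed

end

section \<open>Uniqueness for the Cauchy problem\<close>

text \<open>Vanishing Cauchy data, stated by limits because neither \<open>h\<close> nor its derivative is controlled at the
interaction points themselves.\<close>

definition zero_data :: "(real \<Rightarrow> complex) \<Rightarrow> real \<Rightarrow> bool" where
  "zero_data h t \<longleftrightarrow> (h \<longlongrightarrow> 0) (at t) \<and> (vderiv h \<longlongrightarrow> 0) (at t)"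

lemma tendsto_zero_near:
  assumes "(f \<longlongrightarrow> 0) F" "(g \<longlongrightarrow> 0) F" "\<forall>\<^sub>F y in F. y \<in> A" "F \<noteq> bot"
  shows "\<forall>e>0. \<exists>s\<in>A. cmod (f s) < e \<and> cmod (g s) < e"
proof (intro allI impI)
  fix e :: real assume "e > 0"
  then have "\<forall>\<^sub>F y in F. cmod (f y) < e" "\<forall>\<^sub>F y in F. cmod (g y) < e"
    using assms(1,2) by (auto simp: tendsto_iff)
  then have "\<forall>\<^sub>F y in F. y \<in> A \<and> cmod (f y) < e \<and> cmod (g y) < e"
    using assms(3) by eventually_elim simp
  then show "\<exists>s\<in>A. cmod (f s) < e \<and> cmod (g s) < e"
    using eventually_happens'[OF assms(4)] by blast
qed

context delta_interactions
begin

lemma V_integrable: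
  assumes "c \<le> d" "{c..d} \<subseteq> J"
  shows "(\<lambda>y. cmod (complex_of_real (V y) - z)) integrable_on {c..d}"
proof -
  have "set_integrable lebesgue {c..d} V" using V_loc assms unfolding L1_loc_def by blast
  then have "V absolutely_integrable_on {c..d}" .
  then have "(\<lambda>y. complex_of_real (V y)) absolutely_integrable_on {c..d}"
    using absolutely_integrable_linear[OF _ bounded_linear_of_real] by (simp add: o_def)
  moreover have "(\<lambda>y. z) absolutely_integrable_on {c..d}"
    by (rule absolutely_integrable_on_const) simp
  ultimately have "(\<lambda>y. complex_of_real (V y) - z) absolutely_integrable_on {c..d}"
    by (rule set_integral_diff)
  then show ?thesis by (simp add: absolutely_integrable_on_def)
qed

lemma neighbourhood_small_integral:
  assumes t: "t \<in> J" and e: "e > 0"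
  obtains R where "R > 0" "{t - R..t + R} \<subseteq> J" "{t - R..t + R} \<inter> M \<subseteq> {t}"
    "\<forall>u v. t - R \<le> u \<and> u \<le> v \<and> v \<le> t + R \<longrightarrow> integral {u..v} (\<lambda>y. cmod (complex_of_real (V y) - z)) \<le> e"
proof -
  let ?\<phi> = "\<lambda>y. cmod (complex_of_real (V y) - z)"
  obtain r where r: "r > 0" "{t - r..t + r} \<subseteq> J" "{t - r..t + r} \<inter> M \<subseteq> {t}"
    using isolating_neighbourhood[OF t] .
  have int: "?\<phi> integrable_on {t - r..t + r}" using r by (intro V_integrable) auto
  define F where "F u = integral {t - r..u} ?\<phi>" for u
  have "continuous_on {t - r..t + r} F"
    unfolding F_def by (rule indefinite_integral_continuous_1[OF int])
  then have "isCont F t" using r(1) by (intro continuous_on_interior) auto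
  then obtain d where d: "d > 0" "\<forall>y. dist y t < d \<longrightarrow> dist (F y) (F t) < e / 2"
    using e unfolding continuous_at_eps_delta by (meson half_gt_zero)
  define R where "R = min r (d / 2)"
  have R: "R > 0" "R \<le> r" "R < d" using r d by (auto simp: R_def)
  have sub: "{t - R..t + R} \<subseteq> {t - r..t + r}" using R by auto
  have "integral {u..v} ?\<phi> \<le> e" if uv: "t - R \<le> u" "u \<le> v" "v \<le> t + R" for u v
  proof -
    have "F u + integral {u..v} ?\<phi> = F v"
      unfolding F_def
      by (rule Henstock_Kurzweil_Integration.integral_combine)
        (use uv R in \<open>auto intro!: integrable_on_subinterval[OF int]\<close>)
    moreover have "dist u t < d" "dist v t < d" using uv R by (auto simp: dist_real_def)
    then have "dist (F u) (F t) < e / 2" "dist (F v) (F t) < e / 2" using d(2) by auto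
    ultimately show ?thesis unfolding dist_real_def by linarith
  qed
  then show thesis using R r sub by (intro that[of R]) blast+
qed

text \<open>The integral form of the equation shows that the supremum \<open>L\<close> of \<open>h\<close> and its derivative on a short
interval is at most \<open>L / 2\<close>, hence zero. The hypothesis of arbitrarily small values, instead of a zero,
covers initial data at an inner point as well as initial data that are one-sided limits at \<open>c\<close> or \<open>d\<close>.\<close>

lemma zero_on_short_interval:
  assumes h: "sol w z h" and off: "{c<..<d} \<subseteq> J - M" and short: "d - c \<le> 1 / 2"
    and small: "\<forall>u v. c \<le> u \<and> u \<le> v \<and> v \<le> d \<longrightarrow> integral {u..v} (\<lambda>y. cmod (complex_of_real (V y) - z)) \<le> 1 / 2"
    and bound: "\<forall>y\<in>{c<..<d}. cmod (h y) \<le> K \<and> cmod (vderiv h y) \<le> K"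
    and near_zero: "\<forall>e>0. \<exists>s\<in>{c<..<d}. cmod (h s) < e \<and> cmod (vderiv h s) < e"
  shows "\<forall>y\<in>{c<..<d}. h y = 0 \<and> vderiv h y = 0"
proof -
  let ?S = "(\<lambda>y. cmod (h y)) ` {c<..<d} \<union> (\<lambda>y. cmod (vderiv h y)) ` {c<..<d}"
  define L where "L = Sup ?S"
  obtain s0 where s0: "s0 \<in> {c<..<d}" using near_zero zero_less_one by blast
  have bdd: "bdd_above ?S" using bound by (intro bdd_aboveI[of _ K]) auto
  have L: "cmod (h y) \<le> L" "cmod (vderiv h y) \<le> L" if "y \<in> {c<..<d}" for y
    unfolding L_def using that by (auto intro!: cSup_upper bdd)
  have L0: "L \<ge> 0" using L(1)[OF s0] norm_ge_zero order_trans by blast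
  have step: "cmod (h v - h u) \<le> L / 2 \<and> cmod (vderiv h v - vderiv h u) \<le> L / 2"
    if uv: "u \<in> {c<..<d}" "v \<in> {c<..<d}" "u \<le> v" for u v
  proof
    have sub: "{u..v} \<subseteq> {c<..<d}" using uv by auto
    then have subJ: "{u..v} \<subseteq> J - M" "{u..v} \<subseteq> J" using off by blast+
    note int = solution_has_integral[OF h uv(3) subJ(1)]
    have "cmod (h v - h u) \<le> L * measure lborel {u..v}"
      by (rule has_integral_bound_real[OF L0 finite.emptyI int(1)]) (use L(2) sub in blast)
    also have "\<dots> \<le> L * (1 / 2)" using uv short L0 by (intro mult_left_mono) auto
    finally show "cmod (h v - h u) \<le> L / 2" by simp
    have Vint: "(\<lambda>y. cmod (complex_of_real (V y) - z)) integrable_on {u..v}"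
      by (rule V_integrable[OF uv(3) subJ(2)])
    have "cmod (vderiv h v - vderiv h u) = cmod (integral {u..v} (\<lambda>y. (complex_of_real (V y) - z) * h y))"
      using int(2) by (simp add: integral_unique)
    also have "\<dots> \<le> integral {u..v} (\<lambda>y. L * cmod (complex_of_real (V y) - z))"
    proof (rule integral_norm_bound_integral)
      show "(\<lambda>y. (complex_of_real (V y) - z) * h y) integrable_on {u..v}" using int(2) by blast
      show "(\<lambda>y. L * cmod (complex_of_real (V y) - z)) integrable_on {u..v}"
        using integrable_cmul[OF Vint, of L] by simp
      fix y assume "y \<in> {u..v}"
      then have "cmod (h y) \<le> L" using L(1) sub by blast
      then show "cmod ((complex_of_real (V y) - z) * h y) \<le> L * cmod (complex_of_real (V y) - z)"
        by (metis mult.commute mult_right_mono norm_ge_zero norm_mult)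
    qed
    also have "\<dots> = L * integral {u..v} (\<lambda>y. cmod (complex_of_real (V y) - z))" by simp
    also have "\<dots> \<le> L * (1 / 2)"
      using L0 by (rule mult_left_mono[rotated]) (use uv in \<open>intro small[rule_format], auto\<close>)
    finally show "cmod (vderiv h v - vderiv h u) \<le> L / 2" by simp
  qed
  have half: "cmod (h y) \<le> L / 2 \<and> cmod (vderiv h y) \<le> L / 2" if y: "y \<in> {c<..<d}" for y
  proof -
    have "cmod (h y) \<le> L / 2 + e \<and> cmod (vderiv h y) \<le> L / 2 + e" if e: "e > 0" for e
    proof -
      obtain s where s: "s \<in> {c<..<d}" "cmod (h s) < e" "cmod (vderiv h s) < e"
        using near_zero e by blast
      have "cmod (h y - h s) \<le> L / 2 \<and> cmod (vderiv h y - vderiv h s) \<le> L / 2"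
      proof (cases "s \<le> y")
        case True
        then show ?thesis using step[OF s(1) y] by simp
      next
        case False
        then show ?thesis using step[OF y s(1)] by (simp add: norm_minus_commute)
      qed
      with s(2,3) norm_triangle_sub[of "h y" "h s"] norm_triangle_sub[of "vderiv h y" "vderiv h s"]
      show ?thesis by linarith
    qed
    then show ?thesis by (blast intro: field_le_epsilon)
  qed
  have "L \<le> L / 2"
    unfolding L_def using s0 half[unfolded L_def] by (intro cSup_least) auto
  then have "L = 0" using L0 by simp
  then show ?thesis using L by force
qed

text \<open>Each of the two short intervals adjacent to \<open>t\<close> contains no interaction point, so vanishing data
anywhere on one of them, ends included, give \<open>h = 0\<close> on it. The jump condition carries zero data
across \<open>t\<close>: if \<open>h\<close> tends to 0 there, its derivative has equal one-sided limits.\<close>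

lemma zero_data_propagates:
  assumes h: "sol w z h" and t: "t \<in> J"
  obtains r where "r > 0" "{t - r<..<t + r} \<subseteq> J"
    "\<forall>s\<in>{t - r<..<t + r}. \<forall>s'\<in>{t - r<..<t + r}. zero_data h s \<longrightarrow> zero_data h s'"
proof -
  obtain R where R: "R > 0" "{t - R..t + R} \<subseteq> J" "{t - R..t + R} \<inter> M \<subseteq> {t}"
    "\<forall>u v. t - R \<le> u \<and> u \<le> v \<and> v \<le> t + R \<longrightarrow> integral {u..v} (\<lambda>y. cmod (complex_of_real (V y) - z)) \<le> 1 / 2"
    using neighbourhood_small_integral[OF t, of "1 / 2" z] by auto
  obtain l dl dr where l: "(h \<longlongrightarrow> l) (at_left t)" "(h \<longlongrightarrow> l) (at_right t)"
    "(vderiv h \<longlongrightarrow> dl) (at_left t)" "(vderiv h \<longlongrightarrow> dr) (at_right t)"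
    "dr - dl = complex_of_real (strength w t) * l" using solution_limits[OF h t] .
  \<comment> \<open>A bound for \<open>h\<close> and its derivative near \<open>t\<close>, where the one-sided limits exist.\<close>
  define K where "K = cmod l + cmod dl + cmod dr + 1"
  have "cmod l < K" "cmod dl < K" "cmod dr < K" unfolding K_def
    using norm_ge_zero[of l] norm_ge_zero[of dl] norm_ge_zero[of dr] by linarith+
  then have "\<forall>\<^sub>F y in at_left t. cmod (h y) < K" "\<forall>\<^sub>F y in at_right t. cmod (h y) < K"
    "\<forall>\<^sub>F y in at_left t. cmod (vderiv h y) < K" "\<forall>\<^sub>F y in at_right t. cmod (vderiv h y) < K"
    using l by (auto intro!: order_tendstoD(2)[OF tendsto_norm])
  then have "\<forall>\<^sub>F y in at t. cmod (h y) < K \<and> cmod (vderiv h y) < K"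
    by (simp add: eventually_at_split eventually_conj_iff)
  then obtain R' where R': "R' > 0" "\<forall>y. y \<noteq> t \<and> dist y t < R' \<longrightarrow> cmod (h y) < K \<and> cmod (vderiv h y) < K"
    unfolding eventually_at by auto
  define r where "r = Min {R, R', 1 / 2}"
  have r: "r > 0" "r \<le> R" "r \<le> R'" "r \<le> 1 / 2" using R(1) R'(1) by (auto simp: r_def)
  have big: "{t - r<..<t + r} \<subseteq> {t - R..t + R}" using r by auto
  let ?A = "{t - r<..<t}" and ?B = "{t<..<t + r}"
  have off: "?A \<subseteq> J - M" "?B \<subseteq> J - M"
  proof -
    have "?A \<subseteq> {t - R..t + R} - {t}" "?B \<subseteq> {t - R..t + R} - {t}" using r by auto
    then show "?A \<subseteq> J - M" "?B \<subseteq> J - M" using R(2,3) by blast+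
  qed
  have zeroA: "\<forall>y\<in>?A. h y = 0 \<and> vderiv h y = 0"
    if "\<forall>e>0. \<exists>s\<in>?A. cmod (h s) < e \<and> cmod (vderiv h s) < e"
  proof (rule zero_on_short_interval[OF h off(1) _ _ _ that])
    show "\<forall>y\<in>?A. cmod (h y) \<le> K \<and> cmod (vderiv h y) \<le> K"
      using R'(2) r by (auto simp: dist_real_def intro!: less_imp_le)
  qed (use r R(4) in auto)
  have zeroB: "\<forall>y\<in>?B. h y = 0 \<and> vderiv h y = 0"
    if "\<forall>e>0. \<exists>s\<in>?B. cmod (h s) < e \<and> cmod (vderiv h s) < e"
  proof (rule zero_on_short_interval[OF h off(2) _ _ _ that])
    show "\<forall>y\<in>?B. cmod (h y) \<le> K \<and> cmod (vderiv h y) \<le> K"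
      using R'(2) r by (auto simp: dist_real_def intro!: less_imp_le)
  qed (use r R(4) in auto)
  have evA: "\<forall>\<^sub>F y in at_left t. y \<in> ?A"
    using r(1) unfolding eventually_at_left_field by (intro exI[of _ "t - r"]) auto
  have evB: "\<forall>\<^sub>F y in at_right t. y \<in> ?B"
    using r(1) unfolding eventually_at_right_field by (intro exI[of _ "t + r"]) auto
  have AB: "\<forall>y\<in>?B. h y = 0 \<and> vderiv h y = 0" if A: "\<forall>y\<in>?A. h y = 0 \<and> vderiv h y = 0"
  proof -
    have "\<forall>\<^sub>F y in at_left t. h y = 0" "\<forall>\<^sub>F y in at_left t. vderiv h y = 0"
      using evA A by (auto elim!: eventually_mono)
    then have "(h \<longlongrightarrow> 0) (at_left t)" "(vderiv h \<longlongrightarrow> 0) (at_left t)" by (auto intro: tendsto_eventually)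
    then have "l = 0" "dl = 0" using l by (auto intro: tendsto_unique[rotated])
    then have "(h \<longlongrightarrow> 0) (at_right t)" "(vderiv h \<longlongrightarrow> 0) (at_right t)" using l by auto
    then show ?thesis by (intro zeroB tendsto_zero_near[OF _ _ evB]) auto
  qed
  have BA: "\<forall>y\<in>?A. h y = 0 \<and> vderiv h y = 0" if B: "\<forall>y\<in>?B. h y = 0 \<and> vderiv h y = 0"
  proof -
    have "\<forall>\<^sub>F y in at_right t. h y = 0" "\<forall>\<^sub>F y in at_right t. vderiv h y = 0"
      using evB B by (auto elim!: eventually_mono)
    then have "(h \<longlongrightarrow> 0) (at_right t)" "(vderiv h \<longlongrightarrow> 0) (at_right t)" by (auto intro: tendsto_eventually)
    then have "l = 0" "dr = 0" using l by (auto intro: tendsto_unique[rotated])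
    then have "(h \<longlongrightarrow> 0) (at_left t)" "(vderiv h \<longlongrightarrow> 0) (at_left t)" using l by auto
    then show ?thesis by (intro zeroA tendsto_zero_near[OF _ _ evA]) auto
  qed
  have all: "\<forall>y\<in>?A \<union> ?B. h y = 0 \<and> vderiv h y = 0" if s: "s \<in> {t - r<..<t + r}" "zero_data h s" for s
  proof (cases "s \<le> t")
    case True
    have "\<forall>\<^sub>F y in at_left s. y \<in> ?A"
      using s(1) True r(1) unfolding eventually_at_left_field by (intro exI[of _ "t - r"]) auto
    then have "\<forall>y\<in>?A. h y = 0 \<and> vderiv h y = 0"
      using s(2) unfolding zero_data_def filterlim_at_split
      by (intro zeroA tendsto_zero_near[where F = "at_left s"]) auto
    with AB show ?thesis by blast
  next
    case False
    have "\<forall>\<^sub>F y in at_right s. y \<in> ?B"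
      using s(1) False r(1) unfolding eventually_at_right_field by (intro exI[of _ "t + r"]) auto
    then have "\<forall>y\<in>?B. h y = 0 \<and> vderiv h y = 0"
      using s(2) unfolding zero_data_def filterlim_at_split
      by (intro zeroB tendsto_zero_near[where F = "at_right s"]) auto
    with BA show ?thesis by blast
  qed
  show thesis
  proof (rule that[OF r(1)])
    show "{t - r<..<t + r} \<subseteq> J" using big R(2) by blast
    show "\<forall>s\<in>{t - r<..<t + r}. \<forall>s'\<in>{t - r<..<t + r}. zero_data h s \<longrightarrow> zero_data h s'"
    proof (intro ballI impI)
      fix s s' assume s: "s \<in> {t - r<..<t + r}" "zero_data h s" and s': "s' \<in> {t - r<..<t + r}"
      have "\<forall>\<^sub>F y in at s'. y \<in> {t - r<..<t + r}"
        using s' by (intro eventually_at_in_open') auto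
      moreover have "\<forall>\<^sub>F y in at s'. y \<noteq> t"
      proof (cases "s' = t")
        case True
        then show ?thesis by (simp add: eventually_neq_at_within)
      next
        case False
        then have "\<forall>\<^sub>F y in at s'. y \<in> - {t}" by (intro eventually_at_in_open') auto
        then show ?thesis by simp
      qed
      ultimately have "\<forall>\<^sub>F y in at s'. y \<in> ?A \<union> ?B"
        by eventually_elim auto
      then have "\<forall>\<^sub>F y in at s'. h y = 0" "\<forall>\<^sub>F y in at s'. vderiv h y = 0"
        using all[OF s] by (auto elim!: eventually_mono)
      then show "zero_data h s'" unfolding zero_data_def by (auto intro: tendsto_eventually)
    qed
  qed
qed

text \<open>Uniqueness for the Cauchy problem: the set of points with zero data is open and closed.\<close>

lemma zero_data_imp_zero:
  assumes h: "sol w z h" and t: "t \<in> J" "zero_data h t" and y: "y \<in> J - M"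
  shows "h y = 0"
proof -
  have "zero_data h y"
  proof (rule connected_induction_simple[OF connected_einterval, of t a b y "zero_data h"])
    fix s assume "s \<in> J"
    obtain r where r: "r > 0" "{s - r<..<s + r} \<subseteq> J"
      "\<forall>u\<in>{s - r<..<s + r}. \<forall>v\<in>{s - r<..<s + r}. zero_data h u \<longrightarrow> zero_data h v"
      using zero_data_propagates[OF h \<open>s \<in> J\<close>] .
    show "\<exists>T. openin (top_of_set J) T \<and> s \<in> T \<and> (\<forall>x\<in>T. \<forall>y\<in>T. zero_data h x \<longrightarrow> zero_data h y)"
      using r by (intro exI[of _ "{s - r<..<s + r}"]) (simp add: openin_open_eq)
  qed (use t y in auto)
  moreover have "(h \<longlongrightarrow> h y) (at y)" using solution_derivs(2)[OF h y] by (simp add: isCont_def)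
  ultimately show ?thesis unfolding zero_data_def by (auto intro: tendsto_unique[rotated])
qed

end

section \<open>Square integrable solutions and behaviour at the endpoints\<close>

lemma L2_subset:
  assumes "f \<in> L2 S" "T \<subseteq> S" "T \<in> sets lebesgue" "S \<in> sets lebesgue"
  shows "f \<in> L2 T"
proof -
  have "f \<in> borel_measurable (lebesgue_on T)"
    using assms measurable_restrict_mono[OF _ assms(2), of f lebesgue borel] unfolding L2_def by blast
  moreover have "set_integrable lebesgue S (\<lambda>y. (cmod (f y))\<^sup>2)"
    using assms unfolding L2_def set_integrable_def by (simp add: integrable_restrict_space)
  then have "set_integrable lebesgue T (\<lambda>y. (cmod (f y))\<^sup>2)"
    by (rule set_integrable_subset) (use assms in auto)
  then have "integrable (lebesgue_on T) (\<lambda>y. (cmod (f y))\<^sup>2)"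
    using assms(3) unfolding set_integrable_def by (simp add: integrable_restrict_space)
  ultimately show ?thesis unfolding L2_def by blast
qed

lemma L2_cmult:
  assumes "f \<in> L2 S"
  shows "(\<lambda>y. \<alpha> * f y) \<in> L2 S"
  using assms unfolding L2_def by (auto simp: norm_mult power_mult_distrib)

lemma L2_add:
  assumes "f \<in> L2 S" "g \<in> L2 S"
  shows "(\<lambda>y. f y + g y) \<in> L2 S"
proof -
  have m[measurable]: "f \<in> borel_measurable (lebesgue_on S)" "g \<in> borel_measurable (lebesgue_on S)"
    and i: "integrable (lebesgue_on S) (\<lambda>y. (cmod (f y))\<^sup>2)" "integrable (lebesgue_on S) (\<lambda>y. (cmod (g y))\<^sup>2)"
    using assms unfolding L2_def by auto
  have "integrable (lebesgue_on S) (\<lambda>y. 2 * (cmod (f y))\<^sup>2 + 2 * (cmod (g y))\<^sup>2)"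
    using i by auto
  then have "integrable (lebesgue_on S) (\<lambda>y. (cmod (f y + g y))\<^sup>2)"
  proof (rule Bochner_Integration.integrable_bound)
    show "AE y in lebesgue_on S. norm ((cmod (f y + g y))\<^sup>2) \<le> norm (2 * (cmod (f y))\<^sup>2 + 2 * (cmod (g y))\<^sup>2)"
    proof (intro AE_I2)
      fix y
      have "(cmod (f y + g y))\<^sup>2 \<le> (cmod (f y) + cmod (g y))\<^sup>2"
        by (intro power_mono norm_triangle_ineq norm_ge_zero)
      also have "\<dots> \<le> 2 * (cmod (f y))\<^sup>2 + 2 * (cmod (g y))\<^sup>2"
        using sum_squares_bound[of "cmod (f y)" "cmod (g y)"] by (simp add: power2_sum)
      finally show "norm ((cmod (f y + g y))\<^sup>2) \<le> norm (2 * (cmod (f y))\<^sup>2 + 2 * (cmod (g y))\<^sup>2)"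
        by simp
    qed
  qed measurable
  then show ?thesis unfolding L2_def by auto
qed

lemma L2_AE_cong:
  assumes f: "f \<in> L2 S" and eq: "AE y in lebesgue_on S. g y = f y" and S: "S \<in> sets lebesgue"
  shows "g \<in> L2 S"
proof -
  have fm: "f \<in> borel_measurable (lebesgue_on S)" and fi: "integrable (lebesgue_on S) (\<lambda>y. (cmod (f y))\<^sup>2)"
    using f unfolding L2_def by auto
  have "AE y in lebesgue. y \<in> S \<longrightarrow> g y = f y" using eq S by (simp add: AE_restrict_space_iff)
  then have "AE y in lebesgue. (if y \<in> S then f y else 0) = (if y \<in> S then g y else 0)"
    by (rule eventually_mono) auto
  from borel_measurable_AE[OF _ this] have gm: "g \<in> borel_measurable (lebesgue_on S)"
    using fm unfolding borel_measurable_if[OF S] by simp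
  have "AE y in lebesgue_on S. (cmod (f y))\<^sup>2 = (cmod (g y))\<^sup>2"
    using eq by (rule eventually_mono) simp
  then have "integrable (lebesgue_on S) (\<lambda>y. (cmod (g y))\<^sup>2)"
    using fi integrable_cong_AE[of "\<lambda>y. (cmod (f y))\<^sup>2" "lebesgue_on S" "\<lambda>y. (cmod (g y))\<^sup>2"] fm gm by simp
  with gm show ?thesis unfolding L2_def by blast
qed

text \<open>Both pairs of boundary values are orthogonal to the nonzero vector of \<open>cos \<phi>\<close> and \<open>sin \<phi>\<close>, hence
they are linearly dependent.\<close>

lemma boundary_condition_wronskian:
  assumes f: "boundary_condition F \<phi> f" and g: "boundary_condition F \<phi> g"
    and W: "\<forall>\<^sub>F y in F. wronskian f g y = c" and F: "F \<noteq> bot"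
  shows "c = 0"
proof -
  obtain l d where l: "(f \<longlongrightarrow> l) F" "(vderiv f \<longlongrightarrow> d) F"
    and 1: "l * complex_of_real (cos \<phi>) + d * complex_of_real (sin \<phi>) = 0"
    using f unfolding boundary_condition_def by blast
  obtain l' d' where l': "(g \<longlongrightarrow> l') F" "(vderiv g \<longlongrightarrow> d') F"
    and 2: "l' * complex_of_real (cos \<phi>) + d' * complex_of_real (sin \<phi>) = 0"
    using g unfolding boundary_condition_def by blast
  have "(wronskian f g \<longlongrightarrow> l * d' - d * l') F"
    unfolding wronskian_def using l l' by (intro tendsto_intros)
  from tendsto_unique[OF F tendsto_eventually[OF W] this] have c: "c = l * d' - d * l'" .
  have "c * complex_of_real (cos \<phi>) = d' * (l * complex_of_real (cos \<phi>) + d * complex_of_real (sin \<phi>))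
      - d * (l' * complex_of_real (cos \<phi>) + d' * complex_of_real (sin \<phi>))"
    by (simp add: c algebra_simps)
  then have cos: "c * complex_of_real (cos \<phi>) = 0" unfolding 1 2 by simp
  have "c * complex_of_real (sin \<phi>) = l * (l' * complex_of_real (cos \<phi>) + d' * complex_of_real (sin \<phi>))
      - l' * (l * complex_of_real (cos \<phi>) + d * complex_of_real (sin \<phi>))"
    by (simp add: c algebra_simps)
  then have sin: "c * complex_of_real (sin \<phi>) = 0" unfolding 1 2 by simp
  have "cos \<phi> \<noteq> 0 \<or> sin \<phi> \<noteq> 0" by (metis add_0 power_zero_numeral sin_cos_squared_add zero_neq_one)
  then show ?thesis using cos sin by auto
qed

context delta_interactions
begin

lemma AE_off_M:
  assumes "\<And>y. y \<in> J - M \<Longrightarrow> P y"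
  shows "AE y in lebesgue_on J. P y"
proof -
  have "countable M" by simp
  then have "M \<in> null_sets lebesgue"
    by (intro null_sets_completionI countable_imp_null_set_lborel)
  then have "AE y in lebesgue. y \<notin> M" by (rule AE_not_in)
  then have "AE y in lebesgue. y \<in> J \<longrightarrow> P y" by eventually_elim (use assms in auto)
  then show ?thesis by (simp add: AE_restrict_space_iff)
qed

text \<open>The \<open>3 \<times> 3\<close> determinant with rows \<open>(u, f, g)\<close>, \<open>(u, f, g)\<close>, \<open>(u', f', g')\<close> vanishes; its expansion
expresses \<open>u\<close> by \<open>f\<close> and \<open>g\<close> with coefficients that are quotients of constant Wronskians.\<close>

lemma L2_solution_span:
  assumes f: "sol w z f" "f \<in> L2 J" and g: "sol w z g" "g \<in> L2 J"
    and c: "c \<noteq> 0" "\<forall>y\<in>J - M. wronskian f g y = c" and u: "sol w z u"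
  shows "u \<in> L2 J"
proof -
  obtain cf where cf: "\<And>y. y \<in> J - M \<Longrightarrow> wronskian u f y = cf"
    using wronskian_const[OF u f(1)] by blast
  obtain cg where cg: "\<And>y. y \<in> J - M \<Longrightarrow> wronskian u g y = cg"
    using wronskian_const[OF u g(1)] by blast
  have "u y = (cg / c) * f y + (- cf / c) * g y" if y: "y \<in> J - M" for y
  proof -
    have "u y * wronskian f g y = f y * wronskian u g y - g y * wronskian u f y"
      by (simp add: wronskian_def algebra_simps)
    then show ?thesis using c y cf[OF y] cg[OF y] by (simp add: field_simps)
  qed
  then have ae: "AE y in lebesgue_on J. u y = (cg / c) * f y + (- cf / c) * g y" by (rule AE_off_M)
  have L: "(\<lambda>y. (cg / c) * f y + (- cf / c) * g y) \<in> L2 J" by (intro L2_add L2_cmult f(2) g(2))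
  show ?thesis by (rule L2_AE_cong[OF L ae]) simp
qed

text \<open>At one end of the interval, either some solution is not square integrable (so \<open>f\<close> and \<open>g\<close> cannot span
the solutions), or both functions satisfy the same boundary condition along a filter \<open>F\<close>. The
hypothesis is symmetric in the two ends; in applications the other end is an interaction point, near which
every solution is square integrable.\<close>

lemma wronskian_zero:
  assumes f: "sol w z f" "f \<in> L2 J" and g: "sol w z g" "g \<in> L2 J"
    and endpoint: "(\<exists>u. sol w z u \<and> u \<notin> L2 J) \<or>
      (\<exists>F \<phi>. F \<noteq> bot \<and> (\<forall>\<^sub>F y in F. y \<in> J - M) \<and> boundary_condition F \<phi> f \<and> boundary_condition F \<phi> g)"
  shows "\<forall>y\<in>J - M. wronskian f g y = 0"
proof -
  obtain c where c: "\<And>y. y \<in> J - M \<Longrightarrow> wronskian f g y = c"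
    using wronskian_const[OF f(1) g(1)] by blast
  have "c = 0"
    using endpoint
  proof (elim disjE exE conjE)
    fix u assume "sol w z u" "u \<notin> L2 J"
    then show "c = 0" using L2_solution_span[OF f g, of c u] c by blast
  next
    fix F \<phi> assume F: "F \<noteq> bot" "\<forall>\<^sub>F y in F. y \<in> J - M" and bc: "boundary_condition F \<phi> f" "boundary_condition F \<phi> g"
    from F(2) have "\<forall>\<^sub>F y in F. wronskian f g y = c" by eventually_elim (rule c)
    then show "c = 0" by (rule boundary_condition_wronskian[OF bc _ F(1)])
  qed
  then show ?thesis using c by blast
qed

end

section \<open>Eigenfunctions and their dependence on one coupling constant\<close>

definition eigenfunction ::
  "ereal \<Rightarrow> ereal \<Rightarrow> (real \<Rightarrow> real) \<Rightarrow> int set \<Rightarrow> (int \<Rightarrow> real) \<Rightarrow> real \<Rightarrow> real \<Rightarrow> (int \<Rightarrow> real) \<Rightarrow> complex \<Rightarrow>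
   (real \<Rightarrow> complex) \<Rightarrow> bool" where
  "eigenfunction a b V I x \<theta> \<gamma> w z f \<longleftrightarrow>
     f \<in> L2 (einterval a b) \<and> is_solution a b V I x w z f \<and>
     (regular_left a b V I x \<longrightarrow> boundary_condition (at_right (real_of_ereal a)) \<theta> f) \<and>
     (regular_right a b V I x \<longrightarrow> boundary_condition (at_left (real_of_ereal b)) \<gamma> f) \<and>
     \<not> (AE y in lebesgue_on (einterval a b). f y = 0)"

text \<open>The image of an eigenfunction under the operator is determined only almost everywhere; the
representative \<open>z f\<close> can be chosen for it.\<close>

lemma in_point_spectrum_H_op:
  "z \<in> point_spectrum (einterval a b) (H_op a b V I x \<theta> \<gamma> w) \<longleftrightarrow> (\<exists>f. eigenfunction a b V I x \<theta> \<gamma> w z f)"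
proof
  assume "z \<in> point_spectrum (einterval a b) (H_op a b V I x \<theta> \<gamma> w)"
  then obtain f g where fg: "(f, g) \<in> H_op a b V I x \<theta> \<gamma> w" "AE y in lebesgue_on (einterval a b). g y = z * f y"
    "\<not> (AE y in lebesgue_on (einterval a b). f y = 0)"
    unfolding point_spectrum_def by auto
  have "is_solution a b V I x w z f"
    unfolding is_solution_def
    by (rule delta_expr_AE_cong[OF _ fg(2)]) (use fg(1) in \<open>auto simp: H_op_def T_op_def\<close>)
  then have "eigenfunction a b V I x \<theta> \<gamma> w z f"
    using fg unfolding eigenfunction_def H_op_def T_op_def by auto
  then show "\<exists>f. eigenfunction a b V I x \<theta> \<gamma> w z f" by blast
next
  assume "\<exists>f. eigenfunction a b V I x \<theta> \<gamma> w z f"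
  then obtain f where f: "eigenfunction a b V I x \<theta> \<gamma> w z f" by blast
  then have "(f, \<lambda>y. z * f y) \<in> H_op a b V I x \<theta> \<gamma> w"
    unfolding eigenfunction_def H_op_def T_op_def is_solution_def by (auto intro: L2_cmult)
  moreover have "\<not> (AE y in lebesgue_on (einterval a b). f y = 0)"
    using f unfolding eigenfunction_def by blast
  ultimately show "z \<in> point_spectrum (einterval a b) (H_op a b V I x \<theta> \<gamma> w)"
    unfolding point_spectrum_def by (auto intro!: bexI[of _ "(f, \<lambda>y. z * f y)"])
qed

context delta_interactions
begin

lemma restrict_interactions:
  assumes "einterval a' b' \<subseteq> J"
  shows "delta_interactions a' b' V {k \<in> I. x k \<in> einterval a' b'} x"
proof
  show "L1_loc (einterval a' b') V"
    using V_loc assms unfolding L1_loc_def by (meson order_trans)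
  show "inj_on x {k \<in> I. x k \<in> einterval a' b'}" using x_inj by (auto simp: inj_on_def)
  show "x ` {k \<in> I. x k \<in> einterval a' b'} \<subseteq> einterval a' b'" by auto
  fix y assume "y \<in> einterval a' b'"
  then have "\<not> y islimpt M" using assms x_discrete by blast
  then show "\<not> y islimpt x ` {k \<in> I. x k \<in> einterval a' b'}"
    by (rule contrapos_nn) (auto elim: islimpt_subset)
qed

text \<open>Suppose that \<open>f\<close> does not vanish at \<open>x n\<close>. On the left and on the right of \<open>x n\<close> both functions solve
the same problem, with the same behaviour at the end \<open>a\<close> or \<open>b\<close>, so their Wronskian is zero on both
sides. At \<open>x n\<close> it jumps by \<open>(r - w n) f h\<close>, so \<open>h\<close> vanishes there. The Wronskian then reduces to
\<open>f h'\<close>, so \<open>h\<close> has zero Cauchy data, and \<open>h = 0\<close> by uniqueness, a contradiction.\<close>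

lemma eigenfunction_vanishes:
  assumes n: "n \<in> I" and r: "r \<noteq> w n"
    and f: "eigenfunction a b V I x \<theta> \<gamma> w z f"
    and h: "eigenfunction a b V I x \<theta> \<gamma> (w(n := r)) z h"
    and left: "regular_left a b V I x \<or> lpc_left a b V I x w"
    and right: "regular_right a b V I x \<or> lpc_right a b V I x w"
  shows "(f \<longlongrightarrow> 0) (at (x n))"
proof -
  define c where "c = x n"
  have cJ: "c \<in> J" using n x_in by (auto simp: c_def)
  have ac: "a < ereal c" "ereal c < b" using cJ by (auto simp: einterval_def)
  have fs: "f \<in> L2 J" "sol w z f" and hs: "h \<in> L2 J" "sol (w(n := r)) z h"
    using f h unfolding eigenfunction_def by auto
  define Il where "Il = {k \<in> I. x k \<in> einterval a (ereal c)}"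
  define Ir where "Ir = {k \<in> I. x k \<in> einterval (ereal c) b}"
  \<comment> \<open>\<open>n\<close> belongs to neither of the restricted index sets, so the two coupling sequences agree on them.\<close>
  have n_notin: "n \<notin> Il" "n \<notin> Ir" by (auto simp: Il_def Ir_def c_def einterval_def)
  have subl: "einterval a (ereal c) \<subseteq> J"
    using ac(2) by (auto simp: einterval_def intro: less_trans[of _ "ereal c"])
  have subr: "einterval (ereal c) b \<subseteq> J"
    using ac(1) by (auto simp: einterval_def intro: less_trans[of _ "ereal c"])
  interpret L: delta_interactions a "ereal c" V Il x
    unfolding Il_def by (rule restrict_interactions[OF subl])
  interpret R: delta_interactions "ereal c" b V Ir x
    unfolding Ir_def by (rule restrict_interactions[OF subr])
  have evc: "\<forall>\<^sub>F y in at c. y \<in> J - M"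
  proof -
    have "\<forall>\<^sub>F y in at c. y \<in> J" using cJ by (intro eventually_at_in_open') auto
    moreover have "\<forall>\<^sub>F y in at c. y \<notin> M" using x_discrete[OF cJ] by (simp add: islimpt_iff_eventually)
    ultimately show ?thesis by eventually_elim simp
  qed
  have evl: "\<forall>\<^sub>F y in at_left c. y \<in> L.J - L.M"
  proof -
    have "\<forall>\<^sub>F y in at_left c. y \<in> J - M" using evc by (simp add: eventually_at_split)
    moreover have "\<forall>\<^sub>F y in at_left c. y < c" by (simp add: eventually_at_filter)
    ultimately show ?thesis by eventually_elim (auto simp: einterval_def Il_def)
  qed
  have evr: "\<forall>\<^sub>F y in at_right c. y \<in> R.J - R.M"
  proof -
    have "\<forall>\<^sub>F y in at_right c. y \<in> J - M" using evc by (simp add: eventually_at_split)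
    moreover have "\<forall>\<^sub>F y in at_right c. y > c" by (simp add: eventually_at_filter)
    ultimately show ?thesis by eventually_elim (auto simp: einterval_def Ir_def)
  qed
  have Wl: "\<forall>y\<in>L.J - L.M. wronskian f h y = 0"
  proof (rule L.wronskian_zero)
    show "L.sol w z f" "L.sol w z h"
      using is_solution_subinterval[OF fs(2) subl Il_def, of w] is_solution_subinterval[OF hs(2) subl Il_def, of w] n_notin
      by (metis fun_upd_other)+
    show "f \<in> L2 L.J" "h \<in> L2 L.J" using L2_subset[OF _ subl] fs(1) hs(1) by auto
    show "(\<exists>u. L.sol w z u \<and> u \<notin> L2 L.J) \<or>
      (\<exists>F \<phi>. F \<noteq> bot \<and> (\<forall>\<^sub>F y in F. y \<in> L.J - L.M) \<and> boundary_condition F \<phi> f \<and> boundary_condition F \<phi> h)"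
      using left
    proof
      assume reg: "regular_left a b V I x"
      then obtain a0 where a0: "a = ereal a0" "\<not> a0 islimpt M"
        unfolding regular_left_def by (cases a) auto
      have "\<forall>\<^sub>F y in at_right a0. y \<notin> M"
        using a0(2) unfolding islimpt_iff_eventually by (simp add: eventually_at_split)
      moreover have "\<forall>\<^sub>F y in at_right a0. y \<in> {a0<..<c}"
        using ac(1) a0 by (intro eventually_at_right_real) auto
      ultimately have "\<forall>\<^sub>F y in at_right a0. y \<in> L.J - L.M"
        by eventually_elim (auto simp: a0 einterval_def Il_def)
      moreover have "boundary_condition (at_right a0) \<theta> f" "boundary_condition (at_right a0) \<theta> h"
        using f h reg a0 unfolding eigenfunction_def by auto
      ultimately show ?thesis by (intro disjI2 exI[of _ "at_right a0"] exI[of _ \<theta>]) simp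
    next
      assume "lpc_left a b V I x w"
      then obtain u where u: "sol w z u" "u \<notin> L2 L.J" using ac unfolding lpc_left_def by blast
      then have "L.sol w z u" by (intro is_solution_subinterval[OF _ subl Il_def]) auto
      with u show ?thesis by blast
    qed
  qed
  have Wr: "\<forall>y\<in>R.J - R.M. wronskian f h y = 0"
  proof (rule R.wronskian_zero)
    show "R.sol w z f" "R.sol w z h"
      using is_solution_subinterval[OF fs(2) subr Ir_def, of w] is_solution_subinterval[OF hs(2) subr Ir_def, of w] n_notin
      by (metis fun_upd_other)+
    show "f \<in> L2 R.J" "h \<in> L2 R.J" using L2_subset[OF _ subr] fs(1) hs(1) by auto
    show "(\<exists>u. R.sol w z u \<and> u \<notin> L2 R.J) \<or>
      (\<exists>F \<phi>. F \<noteq> bot \<and> (\<forall>\<^sub>F y in F. y \<in> R.J - R.M) \<and> boundary_condition F \<phi> f \<and> boundary_condition F \<phi> h)"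
      using right
    proof
      assume reg: "regular_right a b V I x"
      then obtain b0 where b0: "b = ereal b0" "\<not> b0 islimpt M"
        unfolding regular_right_def by (cases b) auto
      have "\<forall>\<^sub>F y in at_left b0. y \<notin> M"
        using b0(2) unfolding islimpt_iff_eventually by (simp add: eventually_at_split)
      moreover have "\<forall>\<^sub>F y in at_left b0. y \<in> {c<..<b0}"
        using ac(2) b0 by (intro eventually_at_left_real) auto
      ultimately have "\<forall>\<^sub>F y in at_left b0. y \<in> R.J - R.M"
        by eventually_elim (auto simp: b0 einterval_def Ir_def)
      moreover have "boundary_condition (at_left b0) \<gamma> f" "boundary_condition (at_left b0) \<gamma> h"
        using f h reg b0 unfolding eigenfunction_def by auto
      ultimately show ?thesis by (intro disjI2 exI[of _ "at_left b0"] exI[of _ \<gamma>]) simp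
    next
      assume "lpc_right a b V I x w"
      then obtain u where u: "sol w z u" "u \<notin> L2 R.J" using ac unfolding lpc_right_def by blast
      then have "R.sol w z u" by (intro is_solution_subinterval[OF _ subr Ir_def]) auto
      with u show ?thesis by blast
    qed
  qed
  obtain l dl dr where l: "(f \<longlongrightarrow> l) (at_left c)" "(f \<longlongrightarrow> l) (at_right c)"
    "(vderiv f \<longlongrightarrow> dl) (at_left c)" "(vderiv f \<longlongrightarrow> dr) (at_right c)"
    "dr - dl = complex_of_real (w n) * l"
    by (rule solution_limits[OF fs(2) cJ, unfolded c_def strength_x[OF n], folded c_def])
  obtain l' dl' dr' where l': "(h \<longlongrightarrow> l') (at_left c)" "(h \<longlongrightarrow> l') (at_right c)"
    "(vderiv h \<longlongrightarrow> dl') (at_left c)" "(vderiv h \<longlongrightarrow> dr') (at_right c)"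
    "dr' - dl' = complex_of_real r * l'"
    by (rule solution_limits[OF hs(2) cJ, unfolded c_def strength_x[OF n] fun_upd_same, folded c_def])
  have "l = 0"
  proof (rule ccontr)
    assume l0: "l \<noteq> 0"
    have lim: "(wronskian f h \<longlongrightarrow> l * dl' - dl * l') (at_left c)" "(wronskian f h \<longlongrightarrow> l * dr' - dr * l') (at_right c)"
      unfolding wronskian_def using l l' by (auto intro!: tendsto_intros)
    have "(wronskian f h \<longlongrightarrow> 0) (at_left c)"
      by (rule tendsto_eventually) (use evl in eventually_elim, use Wl in blast)
    moreover have "(wronskian f h \<longlongrightarrow> 0) (at_right c)"
      by (rule tendsto_eventually) (use evr in eventually_elim, use Wr in blast)
    ultimately have W: "l * dl' - dl * l' = 0" "l * dr' - dr * l' = 0"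
      using tendsto_unique[OF trivial_limit_at_left_real lim(1)]
        tendsto_unique[OF trivial_limit_at_right_real lim(2)] by blast+
    have "(complex_of_real r - complex_of_real (w n)) * l * l' = l * (dr' - dl') - (dr - dl) * l'"
      unfolding l(5) l'(5) by (simp add: algebra_simps)
    also have "\<dots> = 0" using W by (simp add: algebra_simps)
    finally have "l' = 0" using l0 r by simp
    with W l0 have "dl' = 0" "dr' = 0" by auto
    then have "zero_data h c"
      using l' \<open>l' = 0\<close> unfolding zero_data_def filterlim_at_split by simp
    then have "AE y in lebesgue_on J. h y = 0"
      by (intro AE_off_M zero_data_imp_zero[OF hs(2) cJ])
    then show False using h unfolding eigenfunction_def by blast
  qed
  then show ?thesis using l unfolding c_def filterlim_at_split by simp
qed

text \<open>If \<open>f\<close> tends to 0 at \<open>x n\<close>, the jump condition there says that the derivative does not jump, whatever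
the coupling constant is.\<close>

lemma eigenfunction_change_couplings:
  assumes f: "eigenfunction a b V I x \<theta> \<gamma> w z f" and zero: "\<And>n. n \<in> I \<Longrightarrow> (f \<longlongrightarrow> 0) (at (x n))"
  shows "eigenfunction a b V I x \<theta> \<gamma> w' z f"
proof -
  have s: "sol w z f" using f unfolding eigenfunction_def by blast
  have "delta_conditions I x w' f"
    unfolding delta_conditions_def
  proof
    fix n assume n: "n \<in> I"
    then have xn: "x n \<in> J" using x_in by blast
    obtain l dl dr where l: "(f \<longlongrightarrow> l) (at_left (x n))" "(f \<longlongrightarrow> l) (at_right (x n))"
      "(vderiv f \<longlongrightarrow> dl) (at_left (x n))" "(vderiv f \<longlongrightarrow> dr) (at_right (x n))"
      "dr - dl = complex_of_real (w n) * l"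
      by (rule solution_limits[OF s xn, unfolded strength_x[OF n]])
    have "(f \<longlongrightarrow> 0) (at_left (x n))" using zero[OF n] by (simp add: filterlim_at_split)
    then have "l = 0" using l(1) by (auto intro: tendsto_unique[rotated])
    with l show "\<exists>l dl dr. (f \<longlongrightarrow> l) (at_left (x n)) \<and> (f \<longlongrightarrow> l) (at_right (x n)) \<and>
        (vderiv f \<longlongrightarrow> dl) (at_left (x n)) \<and> (vderiv f \<longlongrightarrow> dr) (at_right (x n)) \<and>
        dr - dl = complex_of_real (w' n) * l"
      by (intro exI[of _ 0] exI[of _ dl] exI[of _ dr]) auto
  qed
  with s have "sol w' z f" unfolding is_solution_def delta_expr_def by blast
  with f show ?thesis unfolding eigenfunction_def by blast
qed

end

section \<open>Measurable sets of couplings with a given eigenvalue\<close>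

theorem theorem4p1:
  fixes I :: "int set" and p :: "int \<Rightarrow> real measure"
    and a b :: ereal and V :: "real \<Rightarrow> real" and x :: "int \<Rightarrow> real"
    and \<theta> \<gamma> E :: real and B :: "(int \<Rightarrow> real) set"
  assumes p_prob: "\<And>n. n \<in> I \<Longrightarrow> prob_space (p n)"
    and p_sets: "\<And>n. n \<in> I \<Longrightarrow> sets (p n) = sets borel"
    and p_continuous: "\<And>n r. n \<in> I \<Longrightarrow> emeasure (p n) {r} = 0"
    and "a < b"
    and V_loc: "L1_loc (einterval a b) V"
    and x_inj: "inj_on x I"
    and x_in: "x ` I \<subseteq> einterval a b"
    and x_discrete: "\<And>y. y \<in> einterval a b \<Longrightarrow> \<not> y islimpt x ` I"
    and left_end: "\<And>\<omega>. \<omega> \<in> space (Omega I p) \<Longrightarrow>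
                     regular_left a b V I x \<or> lpc_left a b V I x \<omega>"
    and right_end: "\<And>\<omega>. \<omega> \<in> space (Omega I p) \<Longrightarrow>
                      regular_right a b V I x \<or> lpc_right a b V I x \<omega>"
    and "\<theta> \<in> {0..<pi}" and "\<gamma> \<in> {0..<pi}"
    and B_measurable: "B \<in> sets (Omega I p)"
    and B_subset: "B \<subseteq> A_set a b V I x \<theta> \<gamma> p E"
  shows "emeasure (Omega I p) B = 0 \<or> A_set a b V I x \<theta> \<gamma> p E = space (Omega I p)"
proof (rule disjCI)
  assume all: "A_set a b V I x \<theta> \<gamma> p E \<noteq> space (Omega I p)"
  interpret delta_interactions a b V I x
    by unfold_locales (fact V_loc x_inj x_in x_discrete)+
  let ?eig = "eigenfunction a b V I x \<theta> \<gamma>"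
  have mem: "w \<in> A_set a b V I x \<theta> \<gamma> p E \<longleftrightarrow> w \<in> space (Omega I p) \<and> (\<exists>f. ?eig w (complex_of_real E) f)" for w
    by (simp add: A_set_def in_point_spectrum_H_op)
  show "emeasure (Omega I p) B = 0"
  proof (rule ccontr)
    assume pos: "emeasure (Omega I p) B \<noteq> 0"
    have "\<exists>w\<in>B. \<forall>n\<in>I. \<exists>r. r \<noteq> w n \<and> w(n := r) \<in> B"
      by (rule ex_point_with_other_points_on_all_lines[OF _ p_prob p_sets p_continuous B_measurable pos]) auto
    then obtain w where w: "w \<in> B" "\<And>n. n \<in> I \<Longrightarrow> \<exists>r. r \<noteq> w n \<and> w(n := r) \<in> B" by blast
    then have wS: "w \<in> space (Omega I p)" using B_subset mem by blast
    obtain f where f: "?eig w (complex_of_real E) f" using w B_subset mem by blast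
    have "(f \<longlongrightarrow> 0) (at (x n))" if n: "n \<in> I" for n
    proof -
      obtain r where r: "r \<noteq> w n" "w(n := r) \<in> B" using w(2)[OF n] by blast
      then obtain h where "?eig (w(n := r)) (complex_of_real E) h" using B_subset mem by blast
      then show ?thesis by (rule eigenfunction_vanishes[OF n r(1) f _ left_end[OF wS] right_end[OF wS]])
    qed
    then have "?eig w' (complex_of_real E) f" for w' by (rule eigenfunction_change_couplings[OF f])
    then have "A_set a b V I x \<theta> \<gamma> p E = space (Omega I p)" using mem by blast
    with all show False ..
  qed
qed

end
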